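(* Fix a norm $\|\cdot\|$ on $\mathbb{R}^3$ and a positive $\tau<1$. Then for $\mu$-almost all $\mathrm{SL}_3(\mathbb{Z})g\in X_3=\mathrm{SL}_3(\mathbb{Z})\backslash \mathrm{SL}_3(\mathbb{R})$, for all sufficiently large $T$ there is $n\in\mathbb{Z}^3\setminus\{0\}$ with $\|n\|<T$ and $$|Q_0^g(n)|\ll_g T^{-\tau}.$$
   Context: $Q_0(x,y,z)=x^2+y^2-z^2$ on $\mathbb{R}^3$ (row vectors), and for $g\in\mathrm{SL}_3(\mathbb{R})$, $Q_0^g(v)=Q_0(vg)$. $\mu$ is the $\mathrm{SL}_3(\mathbb{R})$-invariant probability measure on $X_3$ induced by Haar measure. The notation $|Q_0^g(n)|\ll_g T^{-\tau}$ means $|Q_0^g(n)|\le c\,T^{-\tau}$ where the constant $c>0$ may depend on $g$ (and on the fixed norm and $\tau$) but not on $T$; how large $T$ must be may also depend on $g$. *)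

theory Defs
  imports "HOL-Probability.Probability"
begin

definition SL3R :: "(real^3^3) set" where
  "SL3R = {g. det g = 1}"

definition SL3Z :: "(real^3^3) set" where
  "SL3Z = {g \<in> SL3R. \<forall>i j. g $ i $ j \<in> \<int>}"

definition SL3Z_coset :: "real^3^3 \<Rightarrow> (real^3^3) set" where
  "SL3Z_coset g = (\<lambda>\<gamma>. \<gamma> ** g) ` SL3Z"

definition X3 :: "(real^3^3) set set" where
  "X3 = SL3Z_coset ` SL3R"

(* The Borel sigma-algebra of the quotient topology on X3: the generators are exactly the sets
   whose preimage is open in SL3R (with the topology induced from the space of all matrices). *)
definition borel_X3 :: "(real^3^3) set measure" where
  "borel_X3 = sigma X3 {U. U \<subseteq> X3 \<and> openin (top_of_set SL3R) {g \<in> SL3R. SL3Z_coset g \<in> U}}"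

definition X3_act :: "real^3^3 \<Rightarrow> (real^3^3) set \<Rightarrow> (real^3^3) set" where
  "X3_act h x = (\<lambda>g. g ** h) ` x"

(* SL3Z is a lattice in the unimodular group SL3R, so the measure induced on X3 by Haar measure,
   normalised to total mass 1, is the one and only measure with this property. *)
definition invariant_prob_X3 :: "(real^3^3) set measure \<Rightarrow> bool" where
  "invariant_prob_X3 \<mu> \<longleftrightarrow>
     prob_space \<mu> \<and> sets \<mu> = sets borel_X3 \<and> (\<forall>h\<in>SL3R. distr \<mu> \<mu> (X3_act h) = \<mu>)"

definition Q0 :: "real^3 \<Rightarrow> real" where
  "Q0 v = (v $ 1)\<^sup>2 + (v $ 2)\<^sup>2 - (v $ 3)\<^sup>2"

(* v v* g is the product of the row vector v with the matrix g *)
definition Q0_twist :: "real^3^3 \<Rightarrow> real^3 \<Rightarrow> real" where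
  "Q0_twist g v = Q0 (v v* g)"

definition int_vectors :: "(real^3) set" where
  "int_vectors = {v. \<forall>i. v $ i \<in> \<int>}"

definition is_norm :: "(real^3 \<Rightarrow> real) \<Rightarrow> bool" where
  "is_norm N \<longleftrightarrow>
     (\<forall>v. 0 \<le> N v) \<and> (\<forall>v. N v = 0 \<longleftrightarrow> v = 0) \<and>
     (\<forall>a v. N (a *\<^sub>R v) = \<bar>a\<bar> * N v) \<and> (\<forall>v w. N (v + w) \<le> N v + N w)"

end

theory Submission
  imports Defs
begin

text \<open>
  By Fubini's theorem and the invariance of \<open>\<mu>\<close>, it suffices to treat, for a fixed lattice,
  almost every matrix with respect to Lebesgue measure on \<open>3 \<times> 3\<close> matrices. Applying Fubini's theorem
  once more, one may fix a matrix with rows \<open>r1\<close>, \<open>r2\<close>, \<open>r3\<close> and only randomize the shear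
  \<open>r1 + x r3\<close>, \<open>r2 + y r3\<close>, \<open>r3\<close> with \<open>(x, y)\<close> uniform on the unit square.

  For all integer pairs \<open>(a, b)\<close> in a suitable sector there is a real \<open>\<rho>\<close> with
  \<open>Q0 (a r1 + b r2 + \<rho> r3) = 0\<close>, and \<open>(a, b, m)\<close> gives a value \<open>O(T\<^sup>-\<^sup>\<tau>)\<close> of the
  sheared form as soon as \<open>a x + b y + m\<close> is within \<open>T\<^sup>-\<^sup>1\<^sup>-\<^sup>\<tau>\<close> of \<open>\<rho>\<close>, where \<open>a\<close>, \<open>b\<close> are of order \<open>T\<close>.
  That some integer \<open>m\<close> does this is an event of probability of order \<open>T\<^sup>-\<^sup>1\<^sup>-\<^sup>\<tau>\<close>, and for linearly
  independent \<open>(a, b)\<close> these events are independent. There are of the order of \<open>T\<^sup>2\<close> pairwise independent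
  pairs, so by Chebyshev's inequality the probability that none of the events occurs is \<open>O(T\<^sup>\<tau>\<^sup>-\<^sup>1)\<close>.
  This is summable over \<open>T = 2 ^ k\<close>, and the Borel--Cantelli lemma applies.
\<close>

section \<open>Second moments on the torus\<close>

lemma measurable_fst_borel [measurable]: "fst \<in> borel_measurable (borel :: (real \<times> real) measure)"
  and measurable_snd_borel [measurable]: "snd \<in> borel_measurable (borel :: (real \<times> real) measure)"
  by (intro borel_measurable_continuous_onI continuous_intros)+

text \<open>R/Z is modelled by Lebesgue measure on [0,1), as a measure on the whole line; integrands
  are required to be 1-periodic instead of being defined on a quotient.\<close>

definition circle :: "real measure" where
  "circle = uniform_measure lborel {0..<1}"

definition torus :: "(real \<times> real) measure" where
  "torus = circle \<Otimes>\<^sub>M circle"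

lemma sets_circle [measurable_cong, simp]: "sets circle = sets borel"
  by (simp add: circle_def)

lemma space_circle [simp]: "space circle = UNIV"
  by (simp add: circle_def)

lemma prob_space_circle: "prob_space circle"
  unfolding circle_def by (rule prob_space_uniform_measure) auto

interpretation circle: prob_space circle
  by (rule prob_space_circle)

interpretation torus: pair_prob_space circle circle ..

lemma sets_torus [measurable_cong, simp]: "sets torus = sets borel"
  unfolding torus_def by (simp add: borel_prod[symmetric] cong: sets_pair_measure_cong)

lemma space_torus [simp]: "space torus = UNIV"
  by (simp add: torus_def space_pair_measure)

lemma prob_space_torus: "prob_space torus"
  unfolding torus_def by (rule torus.prob_space_axioms)

lemma nn_integral_circle:
  assumes [measurable]: "f \<in> borel_measurable borel"
  shows "(\<integral>\<^sup>+x. f x \<partial>circle) = (\<integral>\<^sup>+x. f x * indicator {0..<1} x \<partial>lborel)"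
  unfolding circle_def by (subst nn_integral_uniform_measure) (auto simp: divide_ennreal_def)

text \<open>By periodicity only the fractional part \<open>r\<close> of the shift matters. The
  shifted interval [r, 1 + r) is cut at 1 and its right piece moved back by one period.\<close>

lemma nn_integral_circle_shift:
  fixes f :: "real \<Rightarrow> ennreal"
  assumes [measurable]: "f \<in> borel_measurable borel"
    and periodic: "\<And>x n. f (x + of_int n) = f x"
  shows "(\<integral>\<^sup>+x. f (x + s) \<partial>circle) = (\<integral>\<^sup>+x. f x \<partial>circle)"
proof -
  define r where "r = frac s"
  have r: "0 \<le> r" "r < 1" by (auto simp: r_def frac_lt_1)
  have *: "f (x + s) = f (x + r)" for x
    using periodic[of "x + r" "\<lfloor>s\<rfloor>"] by (simp add: r_def frac_def)
  have shift: "(\<integral>\<^sup>+x. f (x + u) * indicator {a..<b} x \<partial>lborel)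
      = (\<integral>\<^sup>+x. f x * indicator {a + u..<b + u} x \<partial>lborel)" for a b u
    by (subst (2) nn_integral_real_affine[where c = 1 and t = u])
       (auto intro!: nn_integral_cong simp: indicator_def ac_simps split: if_splits)
  have "(\<integral>\<^sup>+x. f (x + s) \<partial>circle) = (\<integral>\<^sup>+x. f (x + r) * indicator {0..<1} x \<partial>lborel)"
    by (subst nn_integral_circle) (simp_all add: *)
  also have "\<dots> = (\<integral>\<^sup>+x. f x * indicator {r..<1 + r} x \<partial>lborel)"
    using shift[of r 0 1] by simp
  also have "\<dots> = (\<integral>\<^sup>+x. f x * indicator {r..<1} x + f x * indicator {1..<1 + r} x \<partial>lborel)"
    using r by (intro nn_integral_cong) (auto simp: indicator_def)
  also have "\<dots> = (\<integral>\<^sup>+x. f x * indicator {r..<1} x \<partial>lborel)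
      + (\<integral>\<^sup>+x. f x * indicator {1..<1 + r} x \<partial>lborel)"
    by (rule nn_integral_add) auto
  also have "(\<integral>\<^sup>+x. f x * indicator {1..<1 + r} x \<partial>lborel)
      = (\<integral>\<^sup>+x. f x * indicator {0..<r} x \<partial>lborel)"
    using shift[of 1 0 r] periodic[of _ 1] by (simp add: add.commute)
  also have "(\<integral>\<^sup>+x. f x * indicator {r..<1} x \<partial>lborel) + \<dots>
      = (\<integral>\<^sup>+x. f x * indicator {r..<1} x + f x * indicator {0..<r} x \<partial>lborel)"
    by (rule nn_integral_add[symmetric]) auto
  also have "\<dots> = (\<integral>\<^sup>+x. f x * indicator {0..<1} x \<partial>lborel)"
    using r by (intro nn_integral_cong) (auto simp: indicator_def)
  finally show ?thesis
    by (simp add: nn_integral_circle)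
qed

lemma nn_integral_torus:
  assumes "f \<in> borel_measurable borel"
  shows "(\<integral>\<^sup>+p. f p \<partial>torus) = (\<integral>\<^sup>+x. \<integral>\<^sup>+y. f (x, y) \<partial>circle \<partial>circle)"
proof -
  have "f \<in> borel_measurable torus"
    using assms by (simp cong: measurable_cong_sets)
  then show ?thesis
    unfolding torus_def by (rule circle.nn_integral_fst[symmetric])
qed

text \<open>One coordinate at a time by Tonelli; the inner integral is itself a 1-periodic function
  of the first coordinate.\<close>

lemma nn_integral_torus_shift:
  fixes f :: "real \<times> real \<Rightarrow> ennreal"
  assumes [measurable]: "f \<in> borel_measurable borel"
    and periodic: "\<And>x y m n. f (x + of_int m, y + of_int n) = f (x, y)"
  shows "(\<integral>\<^sup>+p. f (p + q) \<partial>torus) = (\<integral>\<^sup>+p. f p \<partial>torus)"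
proof -
  obtain s t where q: "q = (s, t)" by force
  have *: "f \<in> borel_measurable (circle \<Otimes>\<^sub>M circle)"
    using assms(1) unfolding torus_def[symmetric] by (simp cong: measurable_cong_sets)
  have [measurable]: "(\<lambda>x. \<integral>\<^sup>+y. f (x, y) \<partial>circle) \<in> borel_measurable borel"
    using circle.borel_measurable_nn_integral_fst[OF *] by (simp cong: measurable_cong_sets)
  have "(\<integral>\<^sup>+p. f (p + q) \<partial>torus) = (\<integral>\<^sup>+x. \<integral>\<^sup>+y. f (x + s, y + t) \<partial>circle \<partial>circle)"
    by (subst nn_integral_torus) (auto simp: q)
  also have "\<dots> = (\<integral>\<^sup>+x. \<integral>\<^sup>+y. f (x + s, y) \<partial>circle \<partial>circle)"
    using periodic[of _ 0] by (intro nn_integral_cong nn_integral_circle_shift) auto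
  also have "\<dots> = (\<integral>\<^sup>+x. \<integral>\<^sup>+y. f (x, y) \<partial>circle \<partial>circle)"
    using periodic[of _ _ _ 0]
    by (intro nn_integral_circle_shift[where f = "\<lambda>x. \<integral>\<^sup>+y. f (x, y) \<partial>circle"]) auto
  finally show ?thesis
    by (simp add: nn_integral_torus)
qed

text \<open>The left-hand side does not change when the arguments of \<open>f\<close> and \<open>g\<close> are translated
  independently, because every such translation comes from a translation of the torus.
  Averaging over the translations gives the product.\<close>

lemma nn_integral_torus_mult:
  fixes f g :: "real \<Rightarrow> ennreal" and a b c d :: int
  assumes [measurable]: "f \<in> borel_measurable borel" "g \<in> borel_measurable borel"
    and f: "\<And>x n. f (x + of_int n) = f x" and g: "\<And>x n. g (x + of_int n) = g x"
    and det: "a * d - b * c \<noteq> 0"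
  shows "(\<integral>\<^sup>+p. f (a * fst p + b * snd p) * g (c * fst p + d * snd p) \<partial>torus)
    = (\<integral>\<^sup>+x. f x \<partial>circle) * (\<integral>\<^sup>+x. g x \<partial>circle)"
proof -
  define F where "F p = f (a * fst p + b * snd p) * g (c * fst p + d * snd p)" for p :: "real \<times> real"
  have [measurable]: "F \<in> borel_measurable borel"
    unfolding F_def by measurable
  interpret T: prob_space torus by (rule prob_space_torus)
  interpret TT: pair_sigma_finite torus torus ..
  have F_periodic: "F (x + of_int m, y + of_int n) = F (x, y)" for x y m n
    using f[of "a * x + b * y" "a * m + b * n"] g[of "c * x + d * y" "c * m + d * n"]
    by (simp add: F_def algebra_simps)
  define D where "D = real_of_int (a * d - b * c)"
  have D: "D \<noteq> 0" using det unfolding D_def by linarith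
  have translate: "(\<integral>\<^sup>+p. F p \<partial>torus)
     = (\<integral>\<^sup>+p. f (a * fst p + b * snd p + fst q) * g (c * fst p + d * snd p + snd q) \<partial>torus)" for q
  proof -
    \<comment> \<open>Cramer's rule: \<open>w\<close> is the real vector that the matrix with rows
      (a, b) and (c, d) sends to \<open>q\<close>.\<close>
    define w where "w = ((d * fst q - b * snd q) / D, (a * snd q - c * fst q) / D)"
    have "a * fst w + b * snd w = (D * fst q) / D" "c * fst w + d * snd w = (D * snd q) / D"
      unfolding w_def D_def by (simp_all add: algebra_simps flip: add_divide_distrib diff_divide_distrib)
    then have w: "a * fst w + b * snd w = fst q" "c * fst w + d * snd w = snd q"
      using D by simp_all
    have "(\<integral>\<^sup>+p. F p \<partial>torus) = (\<integral>\<^sup>+p. F (p + w) \<partial>torus)"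
      using F_periodic by (intro nn_integral_torus_shift[symmetric]) auto
    also have "(\<lambda>p. F (p + w)) = (\<lambda>p :: real \<times> real. f (a * fst p + b * snd p + fst q) * g (c * fst p + d * snd p + snd q))"
      unfolding F_def w[symmetric] by (simp add: algebra_simps)
    finally show ?thesis .
  qed
  have average: "(\<integral>\<^sup>+q. f (u + fst q) * g (v + snd q) \<partial>torus)
      = (\<integral>\<^sup>+x. f x \<partial>circle) * (\<integral>\<^sup>+x. g x \<partial>circle)" for u v
  proof -
    have "(\<integral>\<^sup>+q. f (u + fst q) * g (v + snd q) \<partial>torus)
        = (\<integral>\<^sup>+x. \<integral>\<^sup>+y. f (u + x) * g (v + y) \<partial>circle \<partial>circle)"
      by (subst nn_integral_torus) auto
    also have "\<dots> = (\<integral>\<^sup>+x. f (x + u) \<partial>circle) * (\<integral>\<^sup>+y. g (y + v) \<partial>circle)"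
      by (simp add: nn_integral_cmult nn_integral_multc add.commute)
    finally show ?thesis
      using f g by (simp add: nn_integral_circle_shift)
  qed
  \<comment> \<open>The torus has total mass 1, so a constant equals its average over all
    translations \<open>q\<close>.\<close>
  have "(\<integral>\<^sup>+p. F p \<partial>torus) = (\<integral>\<^sup>+q. \<integral>\<^sup>+p. F p \<partial>torus \<partial>torus)"
    by (simp add: T.emeasure_space_1[simplified])
  also have "\<dots> = (\<integral>\<^sup>+q. \<integral>\<^sup>+p. f (a * fst p + b * snd p + fst q) * g (c * fst p + d * snd p + snd q)
      \<partial>torus \<partial>torus)"
    by (intro nn_integral_cong translate)
  also have "\<dots> = (\<integral>\<^sup>+p. \<integral>\<^sup>+q. f (a * fst p + b * snd p + fst q) * g (c * fst p + d * snd p + snd q)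
      \<partial>torus \<partial>torus)"
    by (rule TT.Fubini') measurable
  also have "\<dots> = (\<integral>\<^sup>+x. f x \<partial>circle) * (\<integral>\<^sup>+x. g x \<partial>circle)"
    by (simp add: average T.emeasure_space_1[simplified])
  finally show ?thesis
    by (simp add: F_def)
qed

section \<open>Points near the integers and the second-moment bound\<close>

definition near_int :: "real \<Rightarrow> real set" where
  "near_int \<eta> = {t. \<exists>n::int. \<bar>t + of_int n\<bar> \<le> \<eta>}"

lemma near_int_shift: "t + of_int n \<in> near_int \<eta> \<longleftrightarrow> t \<in> near_int \<eta>"
proof
  assume "t + of_int n \<in> near_int \<eta>"
  then obtain m where "\<bar>t + of_int n + of_int m\<bar> \<le> \<eta>" by (auto simp: near_int_def)
  then have "\<bar>t + of_int (n + m)\<bar> \<le> \<eta>" by (simp add: add.assoc)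
  then show "t \<in> near_int \<eta>" unfolding near_int_def by blast
next
  assume "t \<in> near_int \<eta>"
  then obtain m where "\<bar>t + of_int m\<bar> \<le> \<eta>" by (auto simp: near_int_def)
  then have "\<bar>t + of_int n + of_int (m - n)\<bar> \<le> \<eta>" by simp
  then show "t + of_int n \<in> near_int \<eta>" unfolding near_int_def by blast
qed

lemma near_int_borel [measurable]: "near_int \<eta> \<in> sets borel"
proof -
  have "near_int \<eta> = (\<Union>n::int. {t. \<bar>t + of_int n\<bar> \<le> \<eta>})"
    by (auto simp: near_int_def)
  moreover have "{t. \<bar>t + of_int n\<bar> \<le> \<eta>} \<in> sets borel" for n :: int
    by measurable
  ultimately show ?thesis by auto
qed

text \<open>Translation invariance moves the centre to 1/2, where the set meets [0,1) in a single
  interval of length 2 \<open>\<eta>\<close>; this interval stays inside because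
  \<open>\<eta> < 1/2\<close>.\<close>

lemma nn_integral_near_int:
  assumes "0 < \<eta>" "\<eta> < 1/2"
  shows "(\<integral>\<^sup>+x. indicator (near_int \<eta>) (x - r) \<partial>circle) = ennreal (2 * \<eta>)"
proof -
  have per: "(indicator (near_int \<eta>) (x + of_int n) :: ennreal) = indicator (near_int \<eta>) x" for x n
    by (simp add: indicator_def near_int_shift)
  have sh: "(\<integral>\<^sup>+x. indicator (near_int \<eta>) (x + s) \<partial>circle)
      = (\<integral>\<^sup>+x. (indicator (near_int \<eta>) x :: ennreal) \<partial>circle)" for s
    by (rule nn_integral_circle_shift) (auto simp: per)
  have "(\<integral>\<^sup>+x. indicator (near_int \<eta>) (x - r) \<partial>circle)
      = (\<integral>\<^sup>+x. indicator (near_int \<eta>) (x + - (1/2)) \<partial>circle)"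
    unfolding sh using sh[of "- r"] by simp
  also have "\<dots> = (\<integral>\<^sup>+x. indicator (near_int \<eta>) (x + - (1/2)) * indicator {0..<1} x \<partial>lborel)"
    by (rule nn_integral_circle) measurable
  also have "\<dots> = (\<integral>\<^sup>+x. indicator {1/2 - \<eta>..1/2 + \<eta>} x \<partial>lborel)"
  proof (intro nn_integral_cong)
    fix x :: real
    \<comment> \<open>On [0,1) the distance to 1/2 is at most 1/2, so |n| is at most 1/2 +
      \<open>\<eta>\<close>, which is below 1.\<close>
    have zero: "n = 0" if "\<bar>x - 1/2 + of_int n\<bar> \<le> \<eta>" "0 \<le> x" "x < 1" for n :: int
    proof -
      have "\<bar>real_of_int n\<bar> < 1" using that assms by linarith
      then show ?thesis by linarith
    qed
    have "x - 1/2 \<in> near_int \<eta> \<longleftrightarrow> \<bar>x - 1/2\<bar> \<le> \<eta>" if "0 \<le> x" "x < 1"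
    proof
      assume "x - 1/2 \<in> near_int \<eta>"
      then obtain n :: int where n: "\<bar>x - 1/2 + of_int n\<bar> \<le> \<eta>" by (auto simp: near_int_def)
      with zero[OF n that] show "\<bar>x - 1/2\<bar> \<le> \<eta>" by simp
    qed (auto simp: near_int_def intro!: exI[of _ 0])
    moreover have "0 \<le> x" "x < 1" if "\<bar>x - 1/2\<bar> \<le> \<eta>"
      using that assms unfolding abs_le_iff by linarith+
    moreover have "\<bar>x - 1/2\<bar> \<le> \<eta> \<longleftrightarrow> x \<in> {1/2 - \<eta>..1/2 + \<eta>}"
      by (auto simp: abs_le_iff)
    ultimately have "x - 1/2 \<in> near_int \<eta> \<and> x \<in> {0..<1} \<longleftrightarrow> x \<in> {1/2 - \<eta>..1/2 + \<eta>}"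
      by auto
    then show "indicator (near_int \<eta>) (x + - (1/2)) * indicator {0..<1} x
        = (indicator {1/2 - \<eta>..1/2 + \<eta>} x :: ennreal)"
      by (auto simp: indicator_def)
  qed
  finally show ?thesis using assms by simp
qed

text \<open>Chebyshev's inequality: the events \<open>u p - \<rho> u \<in> near_int \<eta>\<close>
  are pairwise independent.\<close>

lemma torus_second_moment:
  fixes U :: "(int \<times> int) set" and \<rho> :: "int \<times> int \<Rightarrow> real" and \<eta> :: real
  assumes fin: "finite U" and ne: "U \<noteq> {}" and eta: "0 < \<eta>" "\<eta> < 1/2"
    and indep: "\<And>u v. u \<in> U \<Longrightarrow> v \<in> U \<Longrightarrow> u \<noteq> v \<Longrightarrow> fst u * snd v - snd u * fst v \<noteq> 0"
  defines "E \<equiv> {p :: real \<times> real. \<forall>u\<in>U. fst u * fst p + snd u * snd p - \<rho> u \<notin> near_int \<eta>}"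
  shows "E \<in> sets borel" "measure torus E \<le> 1 / (2 * \<eta> * card U)"
proof -
  interpret T: prob_space torus by (rule prob_space_torus)
  define A where "A u = {p :: real \<times> real. fst u * fst p + snd u * snd p - \<rho> u \<in> near_int \<eta>}" for u :: "int \<times> int"
  have A[measurable]: "A u \<in> sets borel" for u
  proof -
    have "(\<lambda>p. a * fst p + b * snd p - c) \<in> borel_measurable borel" for a b c :: real
      by measurable
    from measurable_sets[OF this near_int_borel] show ?thesis
      by (simp add: A_def vimage_def)
  qed
  have E_eq: "E = - (\<Union>u\<in>U. A u)" by (auto simp: E_def A_def)
  show E[measurable]: "E \<in> sets borel" unfolding E_eq using fin by (intro borel_comp sets.finite_UN A)
  have per: "(indicator (near_int \<eta>) (x + of_int n - r) :: ennreal) = indicator (near_int \<eta>) (x - r)" for x n r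
    using near_int_shift[of "x - r" n \<eta>] by (simp add: indicator_def algebra_simps)
  note near = nn_integral_near_int[OF eta]
  have both: "measure torus (A u \<inter> A v) = 4 * \<eta>\<^sup>2" if "u \<in> U" "v \<in> U" "u \<noteq> v" for u v
  proof -
    have "emeasure torus (A u \<inter> A v) = (\<integral>\<^sup>+p. indicator (A u \<inter> A v) p \<partial>torus)" by simp
    also have "\<dots> = (\<integral>\<^sup>+p. indicator (near_int \<eta>) (fst u * fst p + snd u * snd p - \<rho> u) *
        indicator (near_int \<eta>) (fst v * fst p + snd v * snd p - \<rho> v) \<partial>torus)"
      by (intro nn_integral_cong) (auto simp: A_def indicator_def)
    also have "\<dots> = ennreal (2 * \<eta>) * ennreal (2 * \<eta>)"
      using indep[OF that]
      by (subst nn_integral_torus_mult[where f = "\<lambda>t. indicator (near_int \<eta>) (t - \<rho> u)"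
            and g = "\<lambda>t. indicator (near_int \<eta>) (t - \<rho> v)"])
         (simp_all add: per near)
    also have "\<dots> = ennreal (4 * \<eta>\<^sup>2)"
      using eta by (simp add: power2_eq_square flip: ennreal_mult')
    finally show ?thesis using eta by (simp add: measure_def)
  qed
  have single: "measure torus (A u) = 2 * \<eta>" if u: "u \<noteq> (0, 0)" for u
  proof -
    \<comment> \<open>The vector (-b, a) completes \<open>u\<close> = (a, b) to a pair of
      determinant a^2 + b^2; taking the constant 1 as second factor turns the product formula into a
      single probability.\<close>
    have d: "fst u * fst u - snd u * (- snd u) \<noteq> 0"
      using u by (cases u) (auto simp: sum_squares_eq_zero_iff)
    have "emeasure torus (A u) = (\<integral>\<^sup>+p. indicator (A u) p \<partial>torus)" by simp
    also have "\<dots> = (\<integral>\<^sup>+p. indicator (near_int \<eta>) (fst u * fst p + snd u * snd p - \<rho> u) * 1 \<partial>torus)"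
      by (intro nn_integral_cong) (auto simp: A_def indicator_def)
    also have "\<dots> = ennreal (2 * \<eta>)"
      using nn_integral_torus_mult[OF _ _ _ _ d, where f = "\<lambda>t. indicator (near_int \<eta>) (t - \<rho> u)"
            and g = "\<lambda>_. 1"]
      by (simp add: per near circle.emeasure_space_1[simplified])
    finally show ?thesis using eta by (simp add: measure_def)
  qed
  \<comment> \<open>The zero vector is dependent on every vector, so it can occur only in a
    singleton \<open>U\<close>, where the trivial bound 1 settles the claim.\<close>
  have nz: "u \<noteq> (0, 0)" if u: "u \<in> U" "card U \<noteq> 1" for u
  proof -
    have "U \<noteq> {u}" using u by auto
    then obtain v where "v \<in> U" "v \<noteq> u" using u by blast
    then show ?thesis using indep[of u v] u by auto
  qed
  show "measure torus E \<le> 1 / (2 * \<eta> * card U)"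
  proof (cases "card U = 1")
    case True
    have "1 \<le> 1 / (2 * \<eta>)" using eta by simp
    then show ?thesis using True order_trans[OF T.prob_le_1[of E]] by simp
  next
    case False
    \<comment> \<open>\<open>m\<close> is the expected number of events \<open>A u\<close> that
      occur; the \<open>X u\<close> are their centred indicators.\<close>
    define m where "m = 2 * \<eta> * card U"
    have m: "m > 0" using fin ne eta by (simp add: m_def card_gt_0_iff)
    define X where "X u p = indicator (A u) p - 2 * \<eta>" for u p
    have X[measurable]: "X u \<in> borel_measurable torus" for u
      unfolding X_def by measurable
    have Xb: "\<bar>X u p\<bar> \<le> 1" for u p using eta by (auto simp: X_def indicator_def)
    have Xi: "integrable torus (\<lambda>p. X u p * X v p)" for u v
    proof (rule T.integrable_const_bound[where B = 1])
      show "AE p in torus. norm (X u p * X v p) \<le> 1"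
        by (intro AE_I2) (simp add: abs_mult mult_le_one Xb)
    qed measurable
    have ind: "integrable torus (indicator B :: _ \<Rightarrow> real)" if "B \<in> sets borel" for B
      using that by (intro T.integrable_const_bound[where B = 1]) (auto simp: indicator_def)
    have cov: "(\<integral>p. X u p * X v p \<partial>torus) = (if u = v then 2 * \<eta> * (1 - 2 * \<eta>) else 0)"
      if "u \<in> U" "v \<in> U" for u v
    proof -
      have "(\<integral>p. X u p * X v p \<partial>torus) = (\<integral>p. indicator (A u \<inter> A v) p - 2 * \<eta> * indicator (A u) p
          - 2 * \<eta> * indicator (A v) p + 4 * \<eta>\<^sup>2 \<partial>torus)"
        by (intro Bochner_Integration.integral_cong)
           (auto simp: X_def indicator_def algebra_simps power2_eq_square)
      also have "\<dots> = measure torus (A u \<inter> A v) - 2 * \<eta> * measure torus (A u)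
          - 2 * \<eta> * measure torus (A v) + 4 * \<eta>\<^sup>2"
        by (simp add: ind T.prob_space[simplified])
      finally show ?thesis
        using that nz False both[of u v] single[of u] single[of v]
        by (auto simp: algebra_simps power2_eq_square)
    qed
    have "m\<^sup>2 * measure torus E = (\<integral>p. m\<^sup>2 * indicator E p \<partial>torus)"
      by simp
    \<comment> \<open>On \<open>E\<close> every \<open>X u\<close> is -2 \<open>\<eta>\<close>, so
      the squared sum is m^2 there, and elsewhere it is nonnegative. After integration
      \<open>cov\<close> leaves only the diagonal terms.\<close>
    also have "\<dots> \<le> (\<integral>p. (\<Sum>u\<in>U. \<Sum>v\<in>U. X u p * X v p) \<partial>torus)"
    proof (rule integral_mono)
      show "integrable torus (\<lambda>p. m\<^sup>2 * indicator E p)"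
        by (simp add: ind)
      show "integrable torus (\<lambda>p. \<Sum>u\<in>U. \<Sum>v\<in>U. X u p * X v p)"
        by (intro Bochner_Integration.integrable_sum Xi)
      fix p
      have "(\<Sum>u\<in>U. \<Sum>v\<in>U. X u p * X v p) = (\<Sum>u\<in>U. X u p)\<^sup>2"
        by (simp add: power2_eq_square sum_product)
      moreover have "(\<Sum>u\<in>U. X u p) = - m" if "p \<in> E"
      proof -
        have "X u p = - 2 * \<eta>" if "u \<in> U" for u
          using that \<open>p \<in> E\<close> by (simp add: X_def E_eq)
        then show ?thesis by (simp add: m_def)
      qed
      ultimately show "m\<^sup>2 * indicator E p \<le> (\<Sum>u\<in>U. \<Sum>v\<in>U. X u p * X v p)"
        by (cases "p \<in> E") auto
    qed
    also have "\<dots> = (\<Sum>u\<in>U. \<Sum>v\<in>U. \<integral>p. X u p * X v p \<partial>torus)"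
      by (simp add: Xi Bochner_Integration.integral_sum Bochner_Integration.integrable_sum)
    also have "\<dots> = m * (1 - 2 * \<eta>)"
      using fin by (simp add: cov m_def sum.delta)
    also have "\<dots> \<le> m" using m eta by (simp add: mult_le_cancel_left1)
    finally show ?thesis
      unfolding m_def[symmetric] using m by (simp add: power2_eq_square pos_le_divide_eq mult.commute)
  qed
qed

section \<open>Sheared quadratic forms\<close>

lemma continuous_on_vector_matrix_mult [continuous_intros]:
  fixes f :: "'a::topological_space \<Rightarrow> real^3" and g :: "'a \<Rightarrow> real^3^3"
  assumes "continuous_on S f" "continuous_on S g"
  shows "continuous_on S (\<lambda>x. f x v* g x)"
  unfolding vector_matrix_mult_def by (intro continuous_intros assms)

lemma continuous_on_Q0 [continuous_intros]:
  assumes "continuous_on S f"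
  shows "continuous_on S (\<lambda>x. Q0 (f x))"
  unfolding Q0_def by (intro continuous_intros assms)

lemma Q0_scaleR: "Q0 (c *\<^sub>R v) = c\<^sup>2 * Q0 v"
  by (simp add: Q0_def algebra_simps power2_eq_square)

text \<open>Each square changes by w_i (2 v_i + w_i). Hence an error of size T^(-1-\<tau>) at a
  vector of size T changes the form only by O(T^(-\<tau>)).\<close>

lemma Q0_add_bound: "\<bar>Q0 (v + w) - Q0 v\<bar> \<le> 3 * (norm w * (2 * norm v + norm w))"
proof -
  have *: "\<bar>(v $ i + w $ i)\<^sup>2 - (v $ i)\<^sup>2\<bar> \<le> norm w * (2 * norm v + norm w)" for i
  proof -
    have "(v $ i + w $ i)\<^sup>2 - (v $ i)\<^sup>2 = w $ i * (2 * v $ i + w $ i)"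
      by (simp add: power2_eq_square algebra_simps)
    moreover have "\<bar>2 * v $ i + w $ i\<bar> \<le> 2 * norm v + norm w"
      using component_le_norm_cart[of v i] component_le_norm_cart[of w i] by linarith
    ultimately show ?thesis
      using component_le_norm_cart[of w i] by (simp add: abs_mult mult_mono)
  qed
  show ?thesis
    using *[of 1] *[of 2] *[of 3] by (simp add: Q0_def)
qed

lemma bounded_linear_vector_matrix_mult: "bounded_linear (\<lambda>v. v v* (A :: real^3^3))"
  unfolding linear_conv_bounded_linear[symmetric]
  by (intro linearI) (simp_all add: vector_matrix_left_distrib scaleR_vector_matrix_assoc)

text \<open>\<open>vec3 a b t v* A\<close> is the combination a r1 + b r2 + t r3 of the rows of
  \<open>A\<close>.\<close>

definition vec3 :: "real \<Rightarrow> real \<Rightarrow> real \<Rightarrow> real^3" where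
  "vec3 a b t = a *\<^sub>R axis 1 1 + b *\<^sub>R axis 2 1 + t *\<^sub>R axis 3 1"

lemma vec3_nth [simp]: "vec3 a b t $ 1 = a" "vec3 a b t $ 2 = b" "vec3 a b t $ 3 = t"
  by (simp_all add: vec3_def axis_def)

lemma vec3_nth_eta: "vec3 (v $ 1) (v $ 2) (v $ 3) = v"
  by (simp add: vec_eq_iff forall_3)

lemma scaleR_vec3: "c *\<^sub>R vec3 a b t = vec3 (c * a) (c * b) (c * t)"
  by (simp add: vec_eq_iff forall_3)

lemma vec3_add: "vec3 a b t + vec3 a' b' t' = vec3 (a + a') (b + b') (t + t')"
  by (simp add: vec_eq_iff forall_3)

lemma norm_vec3: "norm (vec3 a b t) \<le> \<bar>a\<bar> + \<bar>b\<bar> + \<bar>t\<bar>"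
  using norm_le_l1_cart[of "vec3 a b t"] by (simp add: sum_3)

lemma continuous_on_vec3 [continuous_intros]:
  "continuous_on S f \<Longrightarrow> continuous_on S g \<Longrightarrow> continuous_on S h \<Longrightarrow>
    continuous_on S (\<lambda>x. vec3 (f x) (g x) (h x))"
  unfolding vec3_def by (intro continuous_intros)

text \<open>The sign of \<open>Q0 w\<close> decides the line: if positive, start at (0,0,1) and go
  far along \<open>w\<close>; if negative, come back to (1,0,0) from far away; if zero, the form is
  affine and nonconstant along the line through (0,0,1).\<close>

lemma Q0_changes_sign_along:
  assumes "w \<noteq> 0"
  obtains u s where "Q0 u < 0" "Q0 (u + s *\<^sub>R w) > 0"
proof -
  define \<kappa> where "\<kappa> = Q0 w"
  have exp1: "Q0 (vec3 0 0 1 + s *\<^sub>R w) = - 1 - 2 * s * w $ 3 + s\<^sup>2 * \<kappa>" for s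
    by (simp add: Q0_def \<kappa>_def power2_eq_square algebra_simps)
  have exp2: "Q0 (vec3 1 0 0 + s *\<^sub>R w) = 1 + 2 * s * w $ 1 + s\<^sup>2 * \<kappa>" for s
    by (simp add: Q0_def \<kappa>_def power2_eq_square algebra_simps)
  \<comment> \<open>The quadratic term is made to exceed 1 while the sign of \<open>s\<close> keeps
    the cross term on the favourable side.\<close>
  have large: "\<exists>s. s * x \<le> 0 \<and> s\<^sup>2 * y > 1" if "y > 0" for x y :: real
  proof -
    define t where "t = 1 + 1 / y"
    have "t\<^sup>2 * y = y + 2 + 1 / y" using that by (simp add: t_def power2_eq_square field_simps)
    then have t: "t\<^sup>2 * y > 1" "t \<ge> 0" using that by (auto simp: t_def add_pos_pos)
    show ?thesis
    proof (cases "x \<le> 0")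
      case True
      then show ?thesis using t by (intro exI[of _ t]) (simp add: mult_nonneg_nonpos)
    next
      case False
      then show ?thesis using t by (intro exI[of _ "- t"]) simp
    qed
  qed
  consider "\<kappa> > 0" | "\<kappa> < 0" | "\<kappa> = 0" by linarith
  then show thesis
  proof cases
    case 1
    obtain s where "s * w $ 3 \<le> 0" "s\<^sup>2 * \<kappa> > 1" using large[OF 1] by blast
    then show thesis
      by (intro that[of "vec3 0 0 1" s]) (simp add: Q0_def, simp add: exp1)
  next
    case 2
    obtain s where "s * w $ 1 \<le> 0" "s\<^sup>2 * (- \<kappa>) > 1" using large[of "- \<kappa>" "w $ 1"] 2 by force
    then show thesis
      by (intro that[of "vec3 1 0 0 + s *\<^sub>R w" "- s"]) (simp add: exp2, simp add: Q0_def)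
  next
    case 3
    then have "(w $ 1)\<^sup>2 + (w $ 2)\<^sup>2 = (w $ 3)\<^sup>2" by (simp add: \<kappa>_def Q0_def)
    then have "w $ 3 \<noteq> 0"
      using \<open>w \<noteq> 0\<close> by (auto simp: vec_eq_iff forall_3 sum_power2_eq_zero_iff)
    \<comment> \<open>The value at s is now -1 - 2 s w_3, which equals 1 at s = -1 / w_3.\<close>
    then show thesis
      using exp1[of "- 1 / w $ 3"] 3
      by (intro that[of "vec3 0 0 1" "- 1 / w $ 3"]) (simp add: Q0_def, simp)
  qed
qed

text \<open>Some line in the direction of the third row meets both signs of the form. This is an
  open condition, so the line can be moved to a nonzero first coordinate, rescaled, and
  \<open>p\<close> varied. The zero given by the intermediate value theorem stays between two fixed
  heights, whence a uniform \<open>C\<close>.\<close>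

lemma null_vectors_over_interval:
  fixes A :: "real^3^3"
  assumes "det A \<noteq> 0"
  obtains p1 p2 C where "p1 < p2" "\<And>p. p1 < p \<Longrightarrow> p < p2 \<Longrightarrow> \<exists>s. \<bar>s\<bar> \<le> C \<and> Q0 (vec3 1 p s v* A) = 0"
proof -
  define f where "f v = Q0 (v v* A)" for v
  have f_scale: "f (c *\<^sub>R v) = c\<^sup>2 * f v" for c v
    by (simp add: f_def scaleR_vector_matrix_assoc Q0_scaleR)
  have cont_f [continuous_intros]: "continuous_on S (\<lambda>x. f (g x))" if "continuous_on S g"
    for S :: "'c::topological_space set" and g
    unfolding f_def by (intro continuous_intros that)
  obtain B where B: "A ** B = mat 1" "B ** A = mat 1"
    using assms by (metis invertible_det_nz invertible_def)
  have surj: "u v* B v* A = u" and inj: "u v* A v* B = u" for u :: "real^3"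
    by (simp_all add: vector_matrix_mul_assoc B)
  define e3 where "e3 = vec3 0 0 1"
  have "e3 v* A \<noteq> 0"
  proof
    assume "e3 v* A = 0"
    then have "e3 = 0" using inj[of e3] by simp
    then show False by (simp add: e3_def vec_eq_iff forall_3)
  qed
  then obtain u s where us: "Q0 u < 0" "Q0 (u + s *\<^sub>R (e3 v* A)) > 0"
    by (rule Q0_changes_sign_along)
  define W where "W = {x. f x < 0} \<inter> {x. f (x + s *\<^sub>R e3) > 0}"
  have "open W"
    unfolding W_def by (intro open_Int open_Collect_less continuous_intros)
  moreover have "u v* B \<in> W"
    using us by (simp add: W_def f_def surj vector_matrix_left_distrib scaleR_vector_matrix_assoc)
  ultimately obtain \<epsilon> where \<epsilon>: "\<epsilon> > 0" "ball (u v* B) \<epsilon> \<subseteq> W"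
    using open_contains_ball by blast
  \<comment> \<open>A shift within the ball makes the first coordinate nonzero.\<close>
  define x where "x = (if (u v* B) $ 1 = 0 then u v* B + (\<epsilon> / 2) *\<^sub>R vec3 1 0 0 else u v* B)"
  have "norm (vec3 1 0 0) = 1" by (simp add: vec3_def norm_axis_1)
  then have "x \<in> ball (u v* B) \<epsilon>" using \<epsilon> by (simp add: x_def dist_norm)
  then have xW: "x \<in> W" using \<epsilon> by blast
  have x1: "x $ 1 \<noteq> 0" using \<epsilon> by (simp add: x_def)
  \<comment> \<open>Dividing by the first coordinate multiplies the form by a positive square, so
    both signs survive.\<close>
  define p0 c0 d where "p0 = x $ 2 / x $ 1" and "c0 = x $ 3 / x $ 1" and "d = s / x $ 1"
  have "vec3 1 p0 c0 = (1 / x $ 1) *\<^sub>R x" "vec3 1 p0 (c0 + d) = (1 / x $ 1) *\<^sub>R (x + s *\<^sub>R e3)"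
    using x1 by (simp_all add: vec_eq_iff forall_3 p0_def c0_def d_def e3_def add_divide_distrib)
  then have p0: "f (vec3 1 p0 c0) < 0" "f (vec3 1 p0 (c0 + d)) > 0"
    using xW x1 by (simp_all only: f_scale W_def Int_iff mem_Collect_eq) (simp_all add: zero_less_mult_iff mult_less_0_iff)
  define P where "P = {p. f (vec3 1 p c0) < 0} \<inter> {p. f (vec3 1 p (c0 + d)) > 0}"
  have "open P"
    unfolding P_def by (intro open_Int open_Collect_less continuous_intros)
  then obtain \<delta> where \<delta>: "\<delta> > 0" "ball p0 \<delta> \<subseteq> P"
    using p0 by (metis (mono_tags, lifting) open_contains_ball P_def Int_iff mem_Collect_eq)
  show thesis
  proof (rule that[of "p0 - \<delta>" "p0 + \<delta>" "\<bar>c0\<bar> + \<bar>d\<bar>"])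
    fix p assume "p0 - \<delta> < p" "p < p0 + \<delta>"
    then have "p \<in> ball p0 \<delta>" by (auto simp: dist_real_def)
    then have "f (vec3 1 p c0) < 0" "f (vec3 1 p (c0 + d)) > 0" using \<delta> by (auto simp: P_def)
    \<comment> \<open>Parametrising by \<open>l\<close> in [0,1] treats both signs of
      \<open>d\<close> at once.\<close>
    then have "\<exists>l\<ge>0. l \<le> 1 \<and> f (vec3 1 p (c0 + l * d)) = 0"
      by (intro IVT') (auto intro!: continuous_intros)
    then obtain l where l: "0 \<le> l" "l \<le> 1" "f (vec3 1 p (c0 + l * d)) = 0" by blast
    have "\<bar>l * d\<bar> \<le> 1 * \<bar>d\<bar>" unfolding abs_mult using l by (intro mult_right_mono) auto
    then show "\<exists>s. \<bar>s\<bar> \<le> \<bar>c0\<bar> + \<bar>d\<bar> \<and> Q0 (vec3 1 p s v* A) = 0"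
      using l by (intro exI[of _ "c0 + l * d"]) (auto simp: f_def)
  qed (use \<delta> in simp)
qed

section \<open>Counting coprime pairs\<close>

definition coprime_pairs :: "nat \<Rightarrow> (nat \<times> nat) set" where
  "coprime_pairs M = {(i, j). i \<in> {1..M} \<and> j \<in> {1..M} \<and> coprime i j}"

lemma finite_coprime_pairs [simp]: "finite (coprime_pairs M)"
  by (rule finite_subset[of _ "{1..M} \<times> {1..M}"]) (auto simp: coprime_pairs_def)

text \<open>Telescoping, as 1/(m+1)^2 is at most 1/m - 1/(m+1). Starting with equality at
  \<open>M = 2\<close> yields a constant below 1, which leaves room for coprime pairs.\<close>

lemma sum_inverse_squares: "M \<ge> 2 \<Longrightarrow> (\<Sum>d=2..M. 1 / (real d)\<^sup>2) \<le> 3 / 4 - 1 / real M"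
proof (induction M rule: dec_induct)
  case (step m)
  have "1 / (real (Suc m))\<^sup>2 \<le> 1 / real m - 1 / real (Suc m)"
  proof -
    have "1 / real m - 1 / real (Suc m) = 1 / (real m * real (Suc m))"
      using step by (simp add: field_simps)
    moreover have "1 / (real (Suc m))\<^sup>2 \<le> 1 / (real m * real (Suc m))"
      unfolding power2_eq_square using step by (intro divide_left_mono mult_right_mono) auto
    ultimately show ?thesis by simp
  qed
  then show ?case using step by simp
qed simp

text \<open>A pair with gcd d at least 2 is d times a pair in a box of side \<open>M div d\<close>,
  so by the sum of the 1/d^2 at most 3/4 of all pairs fail to be coprime.\<close>

lemma card_coprime_pairs: "(real M)\<^sup>2 / 4 \<le> card (coprime_pairs M)"
proof (cases "M \<ge> 2")
  case False
  then consider "M = 0" | "M = 1" by linarith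
  then show ?thesis
  proof cases
    case 2
    then have "coprime_pairs M = {(1, 1)}" by (auto simp: coprime_pairs_def)
    then show ?thesis using 2 by simp
  qed simp
next
  case True
  define B where "B d = (\<lambda>(i, j). (d * i, d * j)) ` ({1..M div d} \<times> {1..M div d})" for d :: nat
  have fin: "finite (B d)" for d by (simp add: B_def)
  have cardB: "card (B d) \<le> (M div d)\<^sup>2" for d
    using card_image_le[of "{1..M div d} \<times> {1..M div d}" "\<lambda>(i, j). (d * i, d * j)"]
    by (simp add: B_def power2_eq_square card_cartesian_product)
  have "{1..M} \<times> {1..M} \<subseteq> coprime_pairs M \<union> (\<Union>d\<in>{2..M}. B d)"
  proof
    fix p assume p: "p \<in> {1..M} \<times> {1..M}"
    obtain i j where ij: "p = (i, j)" by force
    show "p \<in> coprime_pairs M \<union> (\<Union>d\<in>{2..M}. B d)"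
    proof (cases "coprime i j")
      case True
      then show ?thesis using p ij by (simp add: coprime_pairs_def)
    next
      case False
      define d where "d = gcd i j"
      have d: "d \<noteq> 0" "d \<noteq> 1" using False p ij by (auto simp: d_def coprime_iff_gcd_eq_1)
      have "d dvd i" "d dvd j" by (auto simp: d_def)
      then obtain i' j' where ij': "i = d * i'" "j = d * j'" by (auto elim!: dvdE)
      have "d \<le> i" using p ij by (simp add: d_def)
      with d have "d \<in> {2..M}" using p ij by auto
      moreover have "p \<in> B d"
        using p ij ij' d by (auto simp: B_def less_eq_div_iff_mult_less_eq ac_simps
            intro!: image_eqI[of _ _ "(i', j')"])
      ultimately show ?thesis by blast
    qed
  qed
  then have "card ({1..M} \<times> {1..M}) \<le> card (coprime_pairs M \<union> (\<Union>d\<in>{2..M}. B d))"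
    using fin by (intro card_mono) auto
  also have "\<dots> \<le> card (coprime_pairs M) + (\<Sum>d=2..M. (M div d)\<^sup>2)"
    using card_Un_le[of "coprime_pairs M" "\<Union>d\<in>{2..M}. B d"] card_UN_le[of "{2..M}" B]
      sum_mono[of "{2..M}" "\<lambda>d. card (B d)" "\<lambda>d. (M div d)\<^sup>2"] cardB
    by simp
  finally have "(real M)\<^sup>2 \<le> card (coprime_pairs M) + (\<Sum>d=2..M. (real (M div d))\<^sup>2)"
    by (simp add: card_cartesian_product power2_eq_square flip: of_nat_mult of_nat_add of_nat_sum)
  moreover have "(\<Sum>d=2..M. (real (M div d))\<^sup>2) \<le> (\<Sum>d=2..M. (real M)\<^sup>2 * (1 / (real d)\<^sup>2))"
  proof (rule sum_mono)
    fix d assume "d \<in> {2..M}"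
    have "(real (M div d))\<^sup>2 \<le> (real M / real d)\<^sup>2"
      by (intro power_mono of_nat_div_le_of_nat) simp
    then show "(real (M div d))\<^sup>2 \<le> (real M)\<^sup>2 * (1 / (real d)\<^sup>2)"
      by (simp add: power_divide)
  qed
  moreover have "\<dots> \<le> (real M)\<^sup>2 * (3 / 4)"
    unfolding sum_distrib_left[symmetric]
  proof (rule mult_left_mono)
    have "1 / real M \<ge> 0" by simp
    then show "(\<Sum>d=2..M. 1 / (real d)\<^sup>2) \<le> 3 / 4"
      using sum_inverse_squares[OF True] by linarith
  qed simp
  ultimately show ?thesis by linarith
qed


section \<open>Dyadic form of the conclusion and approximation by integers\<close>

text \<open>Measuring \<open>n v* A\<close> instead of \<open>n\<close> makes \<open>good\<close> invariant under \<open>SL3Z\<close>; taking \<open>T\<close> and the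
  constant from countable sets makes it a Borel condition.\<close>

definition hits :: "real^3^3 \<Rightarrow> (real^3) set \<Rightarrow> bool" where
  "hits A S \<longleftrightarrow> (\<exists>n\<in>int_vectors - {0}. n v* A \<in> S)"

definition window :: "real \<Rightarrow> real \<Rightarrow> nat \<Rightarrow> (real^3) set" where
  "window \<tau> C k = {v. norm v < C * 2 ^ k \<and> \<bar>Q0 v\<bar> < C * 2 powr (- \<tau> * k)}"

definition good :: "real \<Rightarrow> real^3^3 \<Rightarrow> bool" where
  "good \<tau> A \<longleftrightarrow> (\<exists>C::nat. \<forall>\<^sub>F k in sequentially. hits A (window \<tau> C k))"

lemma window_mono: "C \<le> D \<Longrightarrow> window \<tau> C k \<subseteq> window \<tau> D k"
  by (auto simp: window_def intro: less_le_trans mult_right_mono)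

lemma open_window: "open (window \<tau> C k)"
  unfolding window_def Q0_def
  by (intro open_Collect_conj open_Collect_less continuous_intros)

lemma hits_mono: "hits A S \<Longrightarrow> S \<subseteq> S' \<Longrightarrow> hits A S'"
  by (auto simp: hits_def)

text \<open>The windows grow with the constant, so a real constant may be rounded up to a natural
  number.\<close>

lemma goodI:
  fixes C :: real
  assumes "\<forall>\<^sub>F k in sequentially. hits A (window \<tau> C k)"
  shows "good \<tau> A"
proof -
  obtain D :: nat where "C \<le> D" using real_arch_simple by blast
  then show ?thesis
    unfolding good_def using assms
    by (intro exI[of _ D]) (auto elim!: eventually_mono hits_mono dest: window_mono)
qed

text \<open>For positive \<open>i\<close>, \<open>j\<close> the slope of this vector is \<open>(c + j / (i + j)) / N\<close>, which lies strictly
  between \<open>c / N\<close> and \<open>(c + 1) / N\<close>.\<close>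

definition slope_vector :: "int \<Rightarrow> int \<Rightarrow> nat \<times> nat \<Rightarrow> int \<times> int" where
  "slope_vector N c = (\<lambda>(i, j). (N * (int i + int j), c * (int i + int j) + int j))"

text \<open>The determinant is N (i j' - i' j), and two coprime positive pairs with i j' = i' j
  coincide.\<close>

lemma slope_vector_independent:
  assumes "N \<noteq> 0" "p \<in> coprime_pairs M" "q \<in> coprime_pairs M" "p \<noteq> q"
  shows "fst (slope_vector N c p) * snd (slope_vector N c q)
      - snd (slope_vector N c p) * fst (slope_vector N c q) \<noteq> 0"
proof
  obtain i j i' j' where ij: "p = (i, j)" "q = (i', j')" by (metis surj_pair)
  assume "fst (slope_vector N c p) * snd (slope_vector N c q)
      - snd (slope_vector N c p) * fst (slope_vector N c q) = 0"
  moreover have "fst (slope_vector N c p) * snd (slope_vector N c q)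
      - snd (slope_vector N c p) * fst (slope_vector N c q) = N * (int i * int j' - int i' * int j)"
    by (simp add: slope_vector_def ij algebra_simps)
  ultimately have "int (i * j') = int (i' * j)" using \<open>N \<noteq> 0\<close> by simp
  then have *: "i * j' = i' * j" by linarith
  have cop: "coprime i j" "coprime i' j'" "i > 0" "j > 0" "i' > 0"
    using assms by (auto simp: coprime_pairs_def ij)
  have "i dvd i' * j" "i' dvd i * j'" using * by (metis dvd_triv_left)+
  then have "i dvd i'" "i' dvd i" using cop
    by (simp_all add: coprime_dvd_mult_left_iff)
  then have "i = i'" by (rule dvd_antisym)
  then show False using * cop assms ij by simp
qed

text \<open>At least 4^k / 4 pairwise independent vectors and \<open>\<eta>\<close> =
  2^(-(1+\<tau>)k) / 4 give a failure probability of at most 8 * 2^((\<tau>-1)k). This is summable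
  because \<open>\<tau> < 1\<close>, so Borel-Cantelli applies.\<close>

lemma AE_torus_approximation:
  fixes N c :: int and \<rho> :: "int \<times> int \<Rightarrow> real" and \<tau> :: real
  assumes "N \<noteq> 0" "0 < \<tau>" "\<tau> < 1"
  shows "AE p in torus. \<forall>\<^sub>F k in sequentially. \<exists>u\<in>slope_vector N c ` coprime_pairs (2 ^ k). \<exists>n::int.
    \<bar>fst u * fst p + snd u * snd p - \<rho> u + n\<bar> \<le> 2 powr (- (1 + \<tau>) * k) / 4"
proof -
  interpret T: prob_space torus by (rule prob_space_torus)
  define U where "U k = slope_vector N c ` coprime_pairs (2 ^ k)" for k
  \<comment> \<open>The divisor 4 keeps \<open>\<eta> k\<close> below 1/2 already at
    \<open>k = 0\<close>.\<close>
  define \<eta> where "\<eta> k = 2 powr (- (1 + \<tau>) * real k) / 4" for k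
  define E where "E k = {p :: real \<times> real. \<forall>u\<in>U k. fst u * fst p + snd u * snd p - \<rho> u \<notin> near_int (\<eta> k)}" for k
  have eta: "0 < \<eta> k" "\<eta> k < 1 / 2" for k
  proof -
    have "2 powr (- (1 + \<tau>) * real k) \<le> 2 powr 0"
      using assms by (intro powr_mono) (auto intro!: mult_nonpos_nonneg)
    then show "0 < \<eta> k" "\<eta> k < 1 / 2" by (simp_all add: \<eta>_def)
  qed
  \<comment> \<open>A vector has determinant 0 with itself, so independence forces distinct
    values.\<close>
  have inj: "inj_on (slope_vector N c) (coprime_pairs M)" for M
    using slope_vector_independent[OF assms(1)] by (intro inj_onI) (metis mult.commute right_minus_eq)
  have card: "(2 ^ k)\<^sup>2 / 4 \<le> real (card (U k))" for k
    using card_coprime_pairs[of "2 ^ k"] by (simp add: U_def card_image[OF inj])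
  have card_pos: "0 < real (card (U k))" for k
    by (rule less_le_trans[OF _ card]) simp
  then have ne: "U k \<noteq> {}" for k by (metis card.empty of_nat_0 less_irrefl)
  have indep: "fst u * snd v - snd u * fst v \<noteq> 0" if uv: "u \<in> U k" "v \<in> U k" "u \<noteq> v" for u v k
  proof -
    obtain p q where "p \<in> coprime_pairs (2 ^ k)" "q \<in> coprime_pairs (2 ^ k)"
      "u = slope_vector N c p" "v = slope_vector N c q" using uv by (fastforce simp: U_def)
    then show ?thesis using slope_vector_independent[OF assms(1), of p _ q c] uv by blast
  qed
  have fin: "finite (U k)" for k by (simp add: U_def)
  have E: "E k \<in> sets borel" "measure torus (E k) \<le> 1 / (2 * \<eta> k * card (U k))" for k
    unfolding E_def
    by (rule torus_second_moment[OF fin ne eta indep]; assumption)+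
  have bound: "measure torus (E k) \<le> 8 * (2 powr (\<tau> - 1)) ^ k" for k
  proof -
    have "measure torus (E k) \<le> 1 / (2 * \<eta> k * card (U k))" by (rule E(2))
    also have "\<dots> \<le> 1 / (2 * \<eta> k * ((2 ^ k)\<^sup>2 / 4))"
      using eta[of k] card[of k] card_pos[of k] by (intro divide_left_mono mult_left_mono) auto
    also have "\<dots> = 8 / (2 powr (- (1 + \<tau>) * real k) * 2 powr (2 * real k))"
      by (simp add: \<eta>_def powr_realpow[symmetric] power2_eq_square flip: powr_add)
    also have "\<dots> = 8 * 2 powr - (- (1 + \<tau>) * real k + 2 * real k)"
      unfolding powr_add[symmetric] powr_minus_divide by simp
    also have "- (- (1 + \<tau>) * real k + 2 * real k) = (\<tau> - 1) * real k"
      by (simp add: algebra_simps)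
    also have "8 * 2 powr ((\<tau> - 1) * real k) = 8 * (2 powr (\<tau> - 1)) ^ k"
      by (simp add: powr_powr[symmetric] powr_realpow)
    finally show ?thesis .
  qed
  have "summable (\<lambda>k. 8 * (2 powr (\<tau> - 1)) ^ k :: real)"
    using assms by (intro summable_mult summable_geometric) (simp add: powr_less_one)
  then have "summable (\<lambda>k. measure torus (E k))"
    by (rule summable_comparison_test') (use bound in auto)
  then have "AE p in torus. \<forall>\<^sub>F k in sequentially. p \<in> space torus - E k"
    using E(1) by (intro borel_cantelli_AE1) (auto simp: T.emeasure_eq_measure)
  then show ?thesis
    by (rule AE_mp) (auto simp: E_def U_def \<eta>_def near_int_def elim!: eventually_mono)
qed

section \<open>Random shears of a fixed matrix\<close>

definition shear :: "real \<times> real \<Rightarrow> real^3^3" where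
  "shear p = (\<chi> i j. if i = j then 1 else if j = 3 then (if i = 1 then fst p else snd p) else 0)"

text \<open>Left multiplication of a matrix by \<open>shear (x, y)\<close> turns its rows into r1 +
  x r3, r2 + y r3, r3; on coefficient vectors this moves only the third coordinate.\<close>

lemma vec3_shear: "vec3 a b t v* shear p = vec3 a b (a * fst p + b * snd p + t)"
  by (simp add: vec_eq_iff forall_3 vector_matrix_mult_def sum_3 shear_def)

lemma det_shear: "det (shear p) = 1"
  by (simp add: det_3 shear_def)

text \<open>Over an integer pair of admissible slope there is a real null vector of size O(2^k). For
  almost every shear and large k, some integer vector is carried to within 2^(-(1+\<tau>)k) of such
  a vector in the third coordinate, which changes the form by O(2^(-\<tau> k)).\<close>

lemma AE_shear_good:
  fixes A :: "real^3^3"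
  assumes "det A \<noteq> 0" "0 < \<tau>" "\<tau> < 1"
  shows "AE p in torus. good \<tau> (shear p ** A)"
proof -
  obtain p1 p2 C where p12: "p1 < p2"
    and null: "\<And>p. p1 < p \<Longrightarrow> p < p2 \<Longrightarrow> \<exists>s. \<bar>s\<bar> \<le> C \<and> Q0 (vec3 1 p s v* A) = 0"
    using null_vectors_over_interval[OF assms(1)] by blast
  then obtain \<sigma> where \<sigma>: "\<And>p. p1 < p \<Longrightarrow> p < p2 \<Longrightarrow> \<bar>\<sigma> p\<bar> \<le> C \<and> Q0 (vec3 1 p (\<sigma> p) v* A) = 0"
    by metis
  obtain K where K: "K > 0" "\<And>v. norm (v v* A) \<le> norm v * K"
    using bounded_linear.pos_bounded[OF bounded_linear_vector_matrix_mult] by blast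
  \<comment> \<open>Stretched by \<open>N\<close>, the interval (p1, p2) has length above 2 and so
    contains some [c, c + 1] with \<open>c\<close> an integer.\<close>
  obtain m :: nat where m: "2 / (p2 - p1) < m" using reals_Archimedean2 by blast
  define N where "N = int m"
  have N: "N > 0" "2 < (p2 - p1) * N"
  proof -
    have "0 < 2 / (p2 - p1)" using p12 by simp
    then have "0 < real m" using m by linarith
    then show "N > 0" by (simp add: N_def)
    show "2 < (p2 - p1) * N" using m p12 by (simp add: N_def pos_divide_less_eq mult.commute)
  qed
  define c where "c = \<lfloor>N * p1\<rfloor> + 1"
  have c: "N * p1 < c" "c + 1 < N * p2"
    using N by (auto simp: c_def algebra_simps) linarith+
  \<comment> \<open>By homogeneity, \<open>a\<close> times the null vector (1, b/a,
    \<open>\<sigma>\<close> (b/a)) has third coordinate \<open>\<rho>\<close> (a, b).\<close>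
  define \<rho> where "\<rho> u = fst u * \<sigma> (snd u / fst u)" for u :: "int \<times> int"
  define P where "P = max \<bar>p1\<bar> \<bar>p2\<bar>"
  \<comment> \<open>For the norm of the null vector: \<open>K\<close> comes from \<open>A\<close>,
    \<open>1 + P + C\<close> from (1, q, s), and 2 N 2^k bounds the factor \<open>a\<close>.\<close>
  define K1 where "K1 = K * (1 + P + C) * (2 * N)"
  have C: "C \<ge> 0" using \<sigma>[of "(p1 + p2) / 2"] p12 by auto
  have P: "P \<ge> 0" by (simp add: P_def)
  have K1: "K1 \<ge> 0" using K C P N by (simp add: K1_def)
  \<comment> \<open>\<open>K1 + K\<close> controls the norm, \<open>3 * K * (2 * K1 + K)\<close> the
    form, and 1 gives strictness.\<close>
  define D where "D = K1 + K + 3 * K * (2 * K1 + K) + 1"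
  have "AE p in torus. \<forall>\<^sub>F k in sequentially. \<exists>u\<in>slope_vector N c ` coprime_pairs (2 ^ k). \<exists>n::int.
    \<bar>fst u * fst p + snd u * snd p - \<rho> u + n\<bar> \<le> 2 powr (- (1 + \<tau>) * k) / 4"
    using N assms by (intro AE_torus_approximation) auto
  then show ?thesis
  proof (rule AE_mp, intro AE_I2 impI)
    fix p :: "real \<times> real"
    assume "\<forall>\<^sub>F k in sequentially. \<exists>u\<in>slope_vector N c ` coprime_pairs (2 ^ k). \<exists>n::int.
      \<bar>fst u * fst p + snd u * snd p - \<rho> u + n\<bar> \<le> 2 powr (- (1 + \<tau>) * k) / 4"
    then have "\<forall>\<^sub>F k in sequentially. hits (shear p ** A) (window \<tau> D k)"
    proof (rule eventually_mono)
      fix k :: nat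
      assume "\<exists>u\<in>slope_vector N c ` coprime_pairs (2 ^ k). \<exists>n::int.
        \<bar>fst u * fst p + snd u * snd p - \<rho> u + n\<bar> \<le> 2 powr (- (1 + \<tau>) * k) / 4"
      then obtain p' and n :: int where p': "p' \<in> coprime_pairs (2 ^ k)"
        and n': "\<bar>fst (slope_vector N c p') * fst p + snd (slope_vector N c p') * snd p
          - \<rho> (slope_vector N c p') + n\<bar> \<le> 2 powr (- (1 + \<tau>) * k) / 4" by blast
      obtain i j where "p' = (i, j)" by force
      note ij = p'[unfolded this] and n = n'[unfolded this]
      define a b where "a = fst (slope_vector N c (i, j))" and "b = snd (slope_vector N c (i, j))"
      have ab: "a = N * (int i + int j)" "b = c * (int i + int j) + int j"
        by (simp_all add: a_def b_def slope_vector_def)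
      have bd: "1 \<le> i" "1 \<le> j" "i \<le> 2 ^ k" "j \<le> 2 ^ k"
        using ij by (auto simp: coprime_pairs_def)
      then have bd': "real i \<le> 2 ^ k" "real j \<le> 2 ^ k"
        using of_nat_mono[of _ "2 ^ k", where 'a = real] by simp_all
      have a_pos: "real_of_int a > 0" using N bd by (simp add: ab)
      have a_le: "real_of_int a \<le> 2 * N * 2 ^ k"
      proof -
        have "real i + real j \<le> 2 * 2 ^ k" using bd' by linarith
        from mult_left_mono[OF this, of "real_of_int N"] show ?thesis using N by (simp add: ab)
      qed
      define q where "q = real_of_int b / real_of_int a"
      have q: "p1 < q" "q < p2"
      proof -
        define r where "r = real i + real j"
        have r: "r > 0" "real j < r" "real j > 0" using bd by (auto simp: r_def)
        have *: "real_of_int a = N * r" "real_of_int b = c * r + j" by (simp_all add: ab r_def)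
        have "p1 * (N * r) < c * r" "(c + 1) * r < p2 * (N * r)"
          using mult_strict_right_mono[OF c(1) r(1)] mult_strict_right_mono[OF c(2) r(1)]
          by (simp_all add: ac_simps)
        moreover have "(c + 1) * r = c * r + r" by (simp add: algebra_simps)
        ultimately have "p1 * (N * r) < c * r + j" "c * r + j < p2 * (N * r)"
          using r by linarith+
        then show "p1 < q" "q < p2"
          using a_pos unfolding q_def by (simp_all add: pos_less_divide_eq pos_divide_less_eq *)
      qed
      define s where "s = \<sigma> q"
      have s: "\<bar>s\<bar> \<le> C" "Q0 (vec3 1 q s v* A) = 0" using \<sigma>[OF q] by (simp_all add: s_def)
      define v0 where "v0 = vec3 a b (a * s) v* A"
      have v0: "v0 = a *\<^sub>R (vec3 1 q s v* A)"
        using a_pos by (simp add: v0_def scaleR_vector_matrix_assoc[symmetric] scaleR_vec3 q_def)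
      then have Q_v0: "Q0 v0 = 0" by (simp add: Q0_scaleR s)
      have norm_v0: "norm v0 \<le> K1 * 2 ^ k"
      proof -
        have "norm (vec3 1 q s) \<le> 1 + P + C"
          using norm_vec3[of 1 q s] s q by (auto simp: P_def)
        then have "norm (vec3 1 q s v* A) \<le> (1 + P + C) * K"
          using K by (intro order_trans[OF K(2)] mult_right_mono) auto
        then have "norm (a *\<^sub>R (vec3 1 q s v* A)) \<le> (2 * N * 2 ^ k) * ((1 + P + C) * K)"
          unfolding norm_scaleR using a_le a_pos by (intro mult_mono) auto
        then have "norm v0 \<le> (2 * N * 2 ^ k) * ((1 + P + C) * K)" unfolding v0 .
        also have "\<dots> = K1 * 2 ^ k" by (simp add: K1_def algebra_simps)
        finally show ?thesis .
      qed
      define \<eta> where "\<eta> = 2 powr (- (1 + \<tau>) * real k)"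
      have \<eta>: "0 < \<eta>" "\<eta> \<le> 1"
      proof -
        have "- (1 + \<tau>) * real k \<le> 0" using assms by (intro mult_nonpos_nonneg) auto
        from powr_mono[OF this, of 2] show "\<eta> \<le> 1" by (simp add: \<eta>_def)
      qed (simp add: \<eta>_def)
      have \<eta>_k: "\<eta> * 2 ^ k = 2 powr (- \<tau> * k)"
      proof -
        have "\<eta> * 2 ^ k = 2 powr (- (1 + \<tau>) * real k + real k)"
          unfolding powr_add by (simp add: \<eta>_def powr_realpow)
        also have "- (1 + \<tau>) * real k + real k = - \<tau> * k" by (simp add: algebra_simps)
        finally show ?thesis .
      qed
      \<comment> \<open>The gap between the sheared third coordinate and that of the null vector:
        (a, b, n) is carried to \<open>v0\<close> plus \<open>e\<close> times the third row.\<close>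
      define e where "e = a * fst p + b * snd p - a * s + n"
      have e: "\<bar>e\<bar> \<le> \<eta>"
      proof -
        have "\<rho> (slope_vector N c (i, j)) = a * s"
          by (simp add: \<rho>_def s_def q_def flip: a_def b_def)
        then have "\<bar>e\<bar> \<le> \<eta> / 4"
          using n unfolding a_def[symmetric] b_def[symmetric] e_def \<eta>_def by simp
        then show ?thesis using \<eta> by linarith
      qed
      define w where "w = vec3 0 0 e v* A"
      have w: "norm w \<le> K * \<eta>"
      proof -
        have "norm (vec3 0 0 e) \<le> \<eta>" using norm_vec3[of 0 0 e] e by simp
        then have "norm (vec3 0 0 e) * K \<le> \<eta> * K" using K(1) by (intro mult_right_mono) auto
        then show ?thesis unfolding w_def
          using K(2)[of "vec3 0 0 e"] by (simp add: mult.commute)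
      qed
      have vec: "vec3 a b n v* (shear p ** A) = v0 + w"
        by (simp add: vector_matrix_mul_assoc[symmetric] vec3_shear v0_def w_def vec3_add e_def add.assoc
            flip: vector_matrix_left_distrib)
      have K\<eta>: "K * \<eta> \<le> K * 2 ^ k"
        using K(1) by (intro mult_left_mono order_trans[OF \<eta>(2)]) simp_all
      have "norm (v0 + w) \<le> (K1 + K) * 2 ^ k"
        using norm_triangle_ineq[of v0 w] norm_v0 w K\<eta> by (simp add: algebra_simps)
      also have "\<dots> < D * 2 ^ k"
      proof -
        have "0 \<le> 3 * K * (2 * K1 + K)" using K(1) K1 by simp
        then have "K1 + K < D" by (simp add: D_def)
        then show ?thesis by simp
      qed
      finally have 1: "norm (v0 + w) < D * 2 ^ k" .
      have "\<bar>Q0 (v0 + w)\<bar> \<le> 3 * (norm w * (2 * norm v0 + norm w))"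
        using Q0_add_bound[of v0 w] Q_v0 by simp
      also have "\<dots> \<le> 3 * ((K * \<eta>) * (2 * (K1 * 2 ^ k) + K * 2 ^ k))"
      proof -
        have "2 * norm v0 + norm w \<le> 2 * (K1 * 2 ^ k) + K * 2 ^ k" using w norm_v0 K\<eta> by linarith
        then show ?thesis using w K(1) \<eta>(1) by (intro mult_left_mono mult_mono) simp_all
      qed
      also have "\<dots> = 3 * K * (2 * K1 + K) * (\<eta> * 2 ^ k)"
        by (simp add: algebra_simps)
      also have "\<dots> < D * 2 powr (- \<tau> * k)"
        unfolding \<eta>_k using K(1) K1 by (intro mult_strict_right_mono) (simp_all add: D_def)
      finally have 2: "\<bar>Q0 (v0 + w)\<bar> < D * 2 powr (- \<tau> * k)" .
      have "vec3 a b n \<in> int_vectors - {0}"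
        using a_pos by (auto simp: int_vectors_def forall_3 vec_eq_iff)
      then show "hits (shear p ** A) (window \<tau> D k)"
        using 1 2 unfolding hits_def window_def vec[symmetric] by blast
    qed
    then show "good \<tau> (shear p ** A)" by (rule goodI)
  qed
qed

section \<open>Almost every lattice\<close>

lemma continuous_on_matrix_mult [continuous_intros]:
  fixes f g :: "'a::topological_space \<Rightarrow> real^3^3"
  assumes "continuous_on S f" "continuous_on S g"
  shows "continuous_on S (\<lambda>x. f x ** g x)"
  unfolding matrix_matrix_mult_def by (intro continuous_intros assms)

lemma continuous_on_det3 [continuous_intros]:
  fixes f :: "'a::topological_space \<Rightarrow> real^3^3"
  assumes "continuous_on S f"
  shows "continuous_on S (\<lambda>x. det (f x))"
  unfolding det_3 by (intro continuous_intros assms)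

lemma continuous_on_shear: "continuous_on S shear"
proof -
  have "continuous_on S (\<lambda>p. if i = j then 1 else if j = 3 then (if i = 1 then fst p else snd p) else 0 :: real)"
    for i j :: 3
    by (cases "i = j"; cases "j = 3"; cases "i = 1") (auto intro!: continuous_intros)
  then show ?thesis
    unfolding shear_def by (intro continuous_intros) auto
qed

lemma open_hits:
  assumes "open S" "continuous_on UNIV f"
  shows "open {x. hits (f x) S}"
proof -
  have "{x. hits (f x) S} = (\<Union>n\<in>int_vectors - {0}. (\<lambda>x. n v* f x) -` S)"
    by (auto simp: hits_def)
  moreover have "open ((\<lambda>x. n v* f x) -` S)" for n
    using assms by (intro open_vimage continuous_intros)
  ultimately show ?thesis by auto
qed

lemma good_borel:
  assumes "continuous_on UNIV f"
  shows "{x. good \<tau> (f x)} \<in> sets borel"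
proof -
  have "{x. hits (f x) (window \<tau> C k)} \<in> sets borel" for C k
    using borel_open[OF open_hits[OF open_window assms]] by simp
  then have [measurable]: "Measurable.pred borel (\<lambda>x. hits (f x) (window \<tau> C k))" for C k
    by (simp add: pred_def)
  have "Measurable.pred borel (\<lambda>x. good \<tau> (f x))"
    unfolding good_def eventually_sequentially by measurable
  then show ?thesis by (simp add: pred_def)
qed

lemma matrix_mult_scaleR_right: "A ** (c *\<^sub>R B) = c *\<^sub>R (A ** B)" for A B :: "real^3^3"
  by (simp add: vec_eq_iff matrix_matrix_mult_def sum_distrib_left mult.left_commute)

lemma det_scaleR_3: "det (c *\<^sub>R A) = c ^ 3 * det A" for A :: "real^3^3"
  by (simp add: det_3 power3_eq_cube algebra_simps)

text \<open>Norms scale by |c| and the form by c^2; the maximum absorbs both. This allows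
  determinants to be normalised.\<close>

lemma good_scaleR:
  assumes "good \<tau> A" "c \<noteq> 0"
  shows "good \<tau> (c *\<^sub>R A)"
proof -
  obtain C :: nat where C: "\<forall>\<^sub>F k in sequentially. hits A (window \<tau> C k)"
    using assms by (auto simp: good_def)
  define D where "D = max \<bar>c\<bar> (c\<^sup>2) * C"
  have "\<forall>\<^sub>F k in sequentially. hits (c *\<^sub>R A) (window \<tau> D k)"
    using C
  proof (rule eventually_mono)
    fix k assume "hits A (window \<tau> C k)"
    then obtain n where n: "n \<in> int_vectors - {0}" "n v* A \<in> window \<tau> C k"
      by (auto simp: hits_def)
    have "\<bar>c\<bar> * norm (n v* A) < \<bar>c\<bar> * (C * 2 ^ k)"
      using n assms by (intro mult_strict_left_mono) (auto simp: window_def)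
    also have "\<dots> \<le> max \<bar>c\<bar> (c\<^sup>2) * (C * 2 ^ k)"
      by (intro mult_right_mono) auto
    finally have 1: "norm (c *\<^sub>R (n v* A)) < D * 2 ^ k"
      by (simp add: D_def mult.assoc)
    have "c\<^sup>2 * \<bar>Q0 (n v* A)\<bar> < c\<^sup>2 * (C * 2 powr (- \<tau> * k))"
      using n assms by (intro mult_strict_left_mono) (auto simp: window_def)
    also have "\<dots> \<le> max \<bar>c\<bar> (c\<^sup>2) * (C * 2 powr (- \<tau> * k))"
      by (intro mult_right_mono) auto
    finally have 2: "\<bar>Q0 (c *\<^sub>R (n v* A))\<bar> < D * 2 powr (- \<tau> * k)"
      by (simp add: D_def mult.assoc Q0_scaleR abs_mult)
    show "hits (c *\<^sub>R A) (window \<tau> D k)"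
      using n(1) 1 2 unfolding hits_def window_def by (auto simp: vector_scaleR_matrix_ac)
  qed
  then show ?thesis by (rule goodI)
qed

section \<open>Almost every matrix\<close>

lemma AE_lborel_iff_negligible:
  fixes P :: "'a::euclidean_space \<Rightarrow> bool"
  shows "(AE x in lborel. P x) \<longleftrightarrow> negligible {x. \<not> P x}"
proof -
  have "(AE x in lborel. P x) \<longleftrightarrow> (AE x in lebesgue. P x)"
    by (simp add: AE_completion_iff)
  also have "\<dots> \<longleftrightarrow> {x. \<not> P x} \<in> null_sets lebesgue"
  proof
    assume "AE x in lebesgue. P x"
    then obtain B where "{x. \<not> P x} \<subseteq> B" "B \<in> null_sets lebesgue"
      by (auto simp: eventually_ae_filter)
    then show "{x. \<not> P x} \<in> null_sets lebesgue"
      using negligible_iff_null_sets negligible_subset by blast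
  qed (auto intro: AE_I')
  finally show ?thesis by (simp add: negligible_iff_null_sets)
qed

text \<open>The new exceptional set lies in the image of the old one under left multiplication by
  the inverse of \<open>M\<close>, and linear maps preserve null sets.\<close>

lemma AE_lborel_matrix_mult:
  fixes M :: "real^3^3" and P :: "real^3^3 \<Rightarrow> bool"
  assumes "det M \<noteq> 0" "AE A in lborel. P A"
  shows "AE A in lborel. P (M ** A)"
proof -
  obtain B where B: "M ** B = mat 1" "B ** M = mat 1"
    using assms(1) by (metis invertible_det_nz invertible_def)
  have "linear (\<lambda>A :: real^3^3. B ** A)"
    by (intro linearI) (simp_all add: matrix_add_ldistrib matrix_mult_scaleR_right)
  then have "(\<lambda>A. B ** A) differentiable_on {A. \<not> P A}"
    by (rule linear_imp_differentiable_on)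
  then have "negligible ((\<lambda>A. B ** A) ` {A. \<not> P A})"
    using assms(2) unfolding AE_lborel_iff_negligible
    by (intro negligible_differentiable_image_negligible) auto
  moreover have "{A. \<not> P (M ** A)} \<subseteq> (\<lambda>A. B ** A) ` {A. \<not> P A}"
  proof
    fix A assume "A \<in> {A. \<not> P (M ** A)}"
    then show "A \<in> (\<lambda>A. B ** A) ` {A. \<not> P A}"
      by (intro image_eqI[of _ _ "M ** A"]) (auto simp: matrix_mul_assoc B)
  qed
  ultimately show ?thesis
    unfolding AE_lborel_iff_negligible by (rule negligible_subset)
qed

text \<open>Each invertible \<open>A\<close> is good after almost every shear, so by Fubini some
  single shear works for almost every \<open>A\<close>; a linear change of variables then removes
  this shear.\<close>

lemma AE_good:
  assumes "0 < \<tau>" "\<tau> < 1"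
  shows "AE A in lborel. det A \<noteq> 0 \<longrightarrow> good \<tau> A"
proof -
  interpret T: prob_space torus by (rule prob_space_torus)
  interpret pair_sigma_finite "lborel :: (real^3^3) measure" torus ..
  have sets: "sets (lborel \<Otimes>\<^sub>M torus) = sets (borel :: ((real^3^3) \<times> (real \<times> real)) measure)"
    by (simp add: borel_prod[symmetric] cong: sets_pair_measure_cong)
  have space: "space (lborel \<Otimes>\<^sub>M torus) = (UNIV :: ((real^3^3) \<times> (real \<times> real)) set)"
    by (simp add: space_pair_measure)
  have "continuous_on UNIV (\<lambda>x :: (real^3^3) \<times> (real \<times> real). shear (snd x) ** fst x)"
    by (intro continuous_intros continuous_on_compose2[OF continuous_on_shear]) auto
  then have good: "{x. good \<tau> (shear (snd x) ** fst x)} \<in> sets borel" by (rule good_borel)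
  have "open {x :: (real^3^3) \<times> (real \<times> real). det (fst x) \<noteq> 0}"
    by (intro open_Collect_neq continuous_intros)
  then have "- {x :: (real^3^3) \<times> (real \<times> real). det (fst x) \<noteq> 0} \<union> {x. good \<tau> (shear (snd x) ** fst x)} \<in> sets borel"
    using good by (intro sets.Un borel_comp) auto
  also have "- {x :: (real^3^3) \<times> (real \<times> real). det (fst x) \<noteq> 0} \<union> {x. good \<tau> (shear (snd x) ** fst x)}
      = {x. det (fst x) \<noteq> 0 \<longrightarrow> good \<tau> (shear (snd x) ** fst x)}"
    by auto
  finally have "{x \<in> space (lborel \<Otimes>\<^sub>M torus). det (fst x) \<noteq> 0 \<longrightarrow> good \<tau> (shear (snd x) ** fst x)}
      \<in> sets (lborel \<Otimes>\<^sub>M torus)"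
    unfolding sets space by simp
  note commute = AE_commute[of "\<lambda>A p. det A \<noteq> 0 \<longrightarrow> good \<tau> (shear p ** A)", OF this]
  have "AE A in lborel. AE p in torus. det A \<noteq> 0 \<longrightarrow> good \<tau> (shear p ** A)"
  proof (rule AE_I2)
    fix A
    show "AE p in torus. det A \<noteq> 0 \<longrightarrow> good \<tau> (shear p ** A)"
      using AE_shear_good[of A \<tau>] assms by (cases "det A = 0") auto
  qed
  then have "AE p in torus. AE A in lborel. det A \<noteq> 0 \<longrightarrow> good \<tau> (shear p ** A)"
    unfolding commute .
  then obtain p where p: "AE A in lborel. det A \<noteq> 0 \<longrightarrow> good \<tau> (shear p ** A)"
    using T.AE_contr by (metis (mono_tags, lifting) AE_mp AE_I2)
  obtain B where B: "shear p ** B = mat 1"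
    using det_shear[of p] by (metis invertible_det_nz invertible_def zero_neq_one)
  then have "det B = 1"
    using det_mul[of "shear p" B] by (simp add: det_shear)
  then have "AE A in lborel. det (B ** A) \<noteq> 0 \<longrightarrow> good \<tau> (shear p ** (B ** A))"
    using p by (intro AE_lborel_matrix_mult[where P = "\<lambda>A. det A \<noteq> 0 \<longrightarrow> good \<tau> (shear p ** A)"]) auto
  then show ?thesis
    by (simp add: matrix_mul_assoc B det_mul \<open>det B = 1\<close>)
qed

section \<open>From powers of two and the Euclidean norm to all T and any norm\<close>

lemma is_norm_bounded:
  assumes "is_norm N"
  obtains K where "K \<ge> 0" "\<And>v. N v \<le> K * norm v"
proof
  show "0 \<le> N (axis 1 1) + N (axis 2 1) + N (axis 3 1)"
    using assms by (simp add: is_norm_def)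
  fix v :: "real^3"
  have eq: "v = v $ 1 *\<^sub>R axis 1 1 + v $ 2 *\<^sub>R axis 2 1 + v $ 3 *\<^sub>R axis 3 1"
    using vec3_nth_eta[of v] by (simp add: vec3_def)
  have "N v \<le> \<bar>v $ 1\<bar> * N (axis 1 1) + \<bar>v $ 2\<bar> * N (axis 2 1) + \<bar>v $ 3\<bar> * N (axis 3 1)"
  proof -
    have tri: "N (x + y) \<le> N x + N y" and sc: "N (a *\<^sub>R x) = \<bar>a\<bar> * N x" for x y a
      using assms by (auto simp: is_norm_def)
    have "N (x + y + z) \<le> N x + N y + N z" for x y z
      using tri[of "x + y" z] tri[of x y] by linarith
    from this[of "v $ 1 *\<^sub>R axis 1 1" "v $ 2 *\<^sub>R axis 2 1" "v $ 3 *\<^sub>R axis 3 1"]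
    show ?thesis unfolding eq[symmetric] sc .
  qed
  also have "\<dots> \<le> norm v * N (axis 1 1) + norm v * N (axis 2 1) + norm v * N (axis 3 1)"
    using assms by (intro add_mono mult_right_mono component_le_norm_cart) (auto simp: is_norm_def)
  finally show "N v \<le> (N (axis 1 1) + N (axis 2 1) + N (axis 3 1)) * norm v"
    by (simp add: algebra_simps)
qed

text \<open>Choose k with D 2^k \<le> T < D 2^(k+1). The inverse of \<open>g\<close> recovers a
  bound on \<open>n\<close> from one on \<open>n v* g\<close>, and rounding T down costs a factor
  2^\<tau>.\<close>

lemma good_imp_small_values:
  assumes "good \<tau> g" "det g \<noteq> 0" "is_norm N" "0 < \<tau>"
  shows "\<exists>c>0. \<forall>\<^sub>F T in at_top. \<exists>n \<in> int_vectors - {0}. N n < T \<and> \<bar>Q0_twist g n\<bar> \<le> c * T powr (- \<tau>)"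
proof -
  obtain C K :: nat where CK: "\<And>k. K \<le> k \<Longrightarrow> hits g (window \<tau> C k)"
    using assms(1) by (auto simp: good_def eventually_sequentially)
  obtain B where B: "g ** B = mat 1"
    using assms(2) by (metis invertible_det_nz invertible_def)
  obtain KN where KN: "KN \<ge> 0" "\<And>v. N v \<le> KN * norm v" using is_norm_bounded[OF assms(3)] by blast
  obtain KB where KB: "KB > 0" "\<And>v. norm (v v* B) \<le> norm v * KB"
    using bounded_linear.pos_bounded[OF bounded_linear_vector_matrix_mult] by blast
  \<comment> \<open>\<open>KN\<close> compares \<open>N\<close> with the Euclidean norm,
    \<open>KB\<close> undoes \<open>g\<close>, and \<open>C\<close> comes from the window; the
    summand 1 makes \<open>N n < T\<close> strict and \<open>D\<close> positive.\<close>
  define D where "D = KN * KB * C + 1"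
  have D: "D > 0" using KN(1) KB(1) by (simp add: D_def add_nonneg_pos)
  \<comment> \<open>The power comes from 2^(-\<tau> k) \<le> 2^\<tau> (T/D)^(-\<tau>); adding 1
    makes \<open>c\<close> positive.\<close>
  define c where "c = C * (2 * D) powr \<tau> + 1"
  have "\<exists>n \<in> int_vectors - {0}. N n < T \<and> \<bar>Q0_twist g n\<bar> \<le> c * T powr (- \<tau>)" if T: "T \<ge> D * 2 ^ K" for T
  proof -
    have TD: "T / D \<ge> 2 ^ K" using T D by (simp add: pos_le_divide_eq mult.commute)
    then have TD1: "T / D \<ge> 1" by (meson one_le_numeral one_le_power order_trans)
    define k where "k = nat \<lfloor>log 2 (T / D)\<rfloor>"
    have "\<lfloor>log 2 (T / D)\<rfloor> = int k" using TD1 by (simp add: k_def)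
    then have "2 powr real k \<le> T / D" "T / D < 2 powr (real k + 1)"
      using TD1 by (subst (asm) floor_log_eq_powr_iff; simp)+
    then have k: "2 ^ k \<le> T / D" "T / D < 2 ^ (k + 1)"
      by (simp_all add: powr_realpow powr_add)
    have "(2::real) ^ K < 2 ^ (k + 1)" using TD k by linarith
    then have "K < k + 1" by (rule power_less_imp_less_exp[rotated]) simp
    then have "K \<le> k" by simp
    then obtain n where n: "n \<in> int_vectors - {0}" "norm (n v* g) < C * 2 ^ k"
      "\<bar>Q0 (n v* g)\<bar> < C * 2 powr (- \<tau> * k)"
      using CK[of k] by (auto simp: hits_def window_def)
    have "n = n v* g v* B" by (simp add: vector_matrix_mul_assoc B)
    then have "norm n \<le> norm (n v* g) * KB" using KB(2)[of "n v* g"] by simp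
    also have "\<dots> \<le> (C * 2 ^ k) * KB" using n(2) KB(1) by (intro mult_right_mono) auto
    finally have "KN * norm n \<le> KN * ((C * 2 ^ k) * KB)" using KN(1) by (rule mult_left_mono)
    with KN(2)[of n] have "N n \<le> KN * KB * C * 2 ^ k" by (simp add: ac_simps)
    also have "\<dots> < D * 2 ^ k" by (simp add: D_def)
    also have "\<dots> \<le> T" using k(1) D by (simp add: pos_le_divide_eq mult.commute)
    finally have 1: "N n < T" .
    have T0: "T > 0" using TD1 D by (simp add: pos_le_divide_eq)
    have "2 powr (- \<tau> * k) = 2 powr \<tau> * (2 ^ (k + 1)) powr (- \<tau>)"
    proof -
      have "((2::real) ^ (k + 1)) powr (- \<tau>) = 2 powr (real (k + 1) * (- \<tau>))"
        by (subst powr_realpow[symmetric]) (simp_all only: powr_powr zero_less_numeral)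
      then have "2 powr \<tau> * ((2::real) ^ (k + 1)) powr (- \<tau>) = 2 powr (\<tau> + real (k + 1) * (- \<tau>))"
        by (simp only: powr_add)
      also have "\<tau> + real (k + 1) * (- \<tau>) = - \<tau> * k" by (simp add: algebra_simps)
      finally show ?thesis ..
    qed
    also have "\<dots> \<le> 2 powr \<tau> * (T / D) powr (- \<tau>)"
      using k(2) TD1 assms(4) by (intro mult_left_mono powr_mono2') auto
    also have "\<dots> = (2 * D) powr \<tau> * T powr (- \<tau>)"
      using T0 D by (simp add: powr_mult powr_divide powr_minus divide_simps)
    finally have "C * 2 powr (- \<tau> * k) \<le> C * ((2 * D) powr \<tau> * T powr (- \<tau>))"
      by (rule mult_left_mono) simp
    also have "\<dots> \<le> c * T powr (- \<tau>)"
      by (simp add: c_def algebra_simps)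
    finally have "\<bar>Q0_twist g n\<bar> \<le> c * T powr (- \<tau>)"
      using n(3) by (simp add: Q0_twist_def)
    then show ?thesis using 1 n(1) by blast
  qed
  then have "\<forall>\<^sub>F T in at_top. \<exists>n \<in> int_vectors - {0}. N n < T \<and> \<bar>Q0_twist g n\<bar> \<le> c * T powr (- \<tau>)"
    unfolding eventually_at_top_linorder by blast
  moreover have "c > 0" by (simp add: c_def add_nonneg_pos)
  ultimately show ?thesis by blast
qed

section \<open>Invariance under \<open>SL3Z\<close>\<close>

lemma SL3Z_mult_int_vector:
  assumes "\<gamma> \<in> SL3Z" "n \<in> int_vectors"
  shows "n v* \<gamma> \<in> int_vectors"
  using assms by (auto simp: SL3Z_def int_vectors_def vector_matrix_mult_def intro!: Ints_sum Ints_mult)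

text \<open>Cramer's rule: as the determinant is 1, the coordinates of the solution are determinants
  of integer matrices. The transpose turns rows into columns.\<close>

lemma SL3Z_solve_int_vector:
  assumes "\<gamma> \<in> SL3Z" "m \<in> int_vectors"
  obtains n where "n \<in> int_vectors" "n v* \<gamma> = m"
proof -
  let ?B = "transpose \<gamma>"
  have det: "det ?B = 1" using assms by (simp add: SL3Z_def SL3R_def)
  define n where "n = (\<chi> k. det (\<chi> i j. if j = k then m $ i else ?B $ i $ j))"
  have "?B *v n = m"
    using cramer[of ?B n m] det by (simp add: n_def)
  then have "n v* \<gamma> = m" by simp
  moreover have "n \<in> int_vectors"
    using assms unfolding int_vectors_def n_def det_3
    by (auto simp: SL3Z_def transpose_def int_vectors_def intro!: Ints_add Ints_diff Ints_mult)
  ultimately show thesis using that by blast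
qed

text \<open>Right multiplication by \<open>\<gamma>\<close> permutes the nonzero integer
  vectors.\<close>

lemma hits_SL3Z:
  assumes "\<gamma> \<in> SL3Z"
  shows "hits (\<gamma> ** g) S \<longleftrightarrow> hits g S"
proof
  assume "hits (\<gamma> ** g) S"
  then obtain n where n: "n \<in> int_vectors" "n \<noteq> 0" "(n v* \<gamma>) v* g \<in> S"
    by (auto simp: hits_def vector_matrix_mul_assoc)
  have "invertible \<gamma>" using assms by (simp add: invertible_det_nz SL3Z_def SL3R_def)
  then obtain B where "\<gamma> ** B = mat 1" by (auto simp: invertible_def)
  then have "n v* \<gamma> v* B = n" by (simp add: vector_matrix_mul_assoc)
  then have "n v* \<gamma> \<noteq> 0" using n(2) by auto
  then show "hits g S"
    using n SL3Z_mult_int_vector[OF assms] by (auto simp: hits_def)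
next
  assume "hits g S"
  then obtain m where m: "m \<in> int_vectors" "m \<noteq> 0" "m v* g \<in> S" by (auto simp: hits_def)
  obtain n where n: "n \<in> int_vectors" "n v* \<gamma> = m" using SL3Z_solve_int_vector[OF assms m(1)] by blast
  then have "n \<noteq> 0" using m(2) by auto
  then show "hits (\<gamma> ** g) S"
    using n m unfolding hits_def by (intro bexI[of _ n]) (auto simp: vector_matrix_mul_assoc[symmetric])
qed

text \<open>All representatives agree and cosets are nonempty, so the existential quantifier
  expresses \<open>hits\<close> on cosets without a choice.\<close>

lemma hits_coset: "(\<exists>g'\<in>SL3Z_coset g. hits (g' ** A) S) \<longleftrightarrow> hits (g ** A) S"
proof -
  have "mat 1 \<in> SL3R" by (simp add: SL3R_def)
  then have "mat 1 \<in> SL3Z" by (simp add: SL3Z_def) (simp add: mat_def)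
  then have "SL3Z_coset g \<noteq> {}" by (auto simp: SL3Z_coset_def)
  then show ?thesis
    by (auto simp: SL3Z_coset_def matrix_mul_assoc[symmetric] hits_SL3Z)
qed

section \<open>Measurability on \<open>X3\<close>\<close>

lemma X3_act_coset: "X3_act h (SL3Z_coset g) = SL3Z_coset (g ** h)"
  by (simp add: X3_act_def SL3Z_coset_def image_image matrix_mul_assoc)

lemma SL3R_mult: "g \<in> SL3R \<Longrightarrow> h \<in> SL3R \<Longrightarrow> g ** h \<in> SL3R"
  by (simp add: SL3R_def det_mul)

lemma space_borel_X3: "space borel_X3 = X3"
  unfolding borel_X3_def by (rule space_measure_of) auto

lemma borel_X3_open:
  assumes "U \<subseteq> X3" "openin (top_of_set SL3R) {g \<in> SL3R. SL3Z_coset g \<in> U}"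
  shows "U \<in> sets borel_X3"
  unfolding borel_X3_def using assms by (subst sets_measure_of) auto

text \<open>Right translation by \<open>h\<close> is continuous on \<open>SL3R\<close> and
  compatible with passing to cosets, so preimages of generators are generators.\<close>

lemma X3_act_measurable:
  assumes "h \<in> SL3R"
  shows "X3_act h \<in> measurable borel_X3 borel_X3"
proof -
  have act: "X3_act h \<in> X3 \<rightarrow> X3"
    using assms by (auto simp: X3_def X3_act_coset SL3R_mult)
  have "X3_act h \<in> measurable borel_X3
      (sigma X3 {U. U \<subseteq> X3 \<and> openin (top_of_set SL3R) {g \<in> SL3R. SL3Z_coset g \<in> U}})"
  proof (rule measurable_measure_of)
    fix U assume "U \<in> {U. U \<subseteq> X3 \<and> openin (top_of_set SL3R) {g \<in> SL3R. SL3Z_coset g \<in> U}}"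
    then have U: "openin (top_of_set SL3R) {g \<in> SL3R. SL3Z_coset g \<in> U}" by blast
    have "openin (top_of_set SL3R) (SL3R \<inter> (\<lambda>g. g ** h) -` {g \<in> SL3R. SL3Z_coset g \<in> U})"
      using assms SL3R_mult by (intro continuous_openin_preimage[OF _ _ U] continuous_intros) auto
    also have "SL3R \<inter> (\<lambda>g. g ** h) -` {g \<in> SL3R. SL3Z_coset g \<in> U}
        = {g \<in> SL3R. SL3Z_coset g \<in> X3_act h -` U \<inter> X3}"
      using assms SL3R_mult by (auto simp: X3_act_coset X3_def)
    finally show "X3_act h -` U \<inter> space borel_X3 \<in> sets borel_X3"
      by (intro borel_X3_open) (auto simp: space_borel_X3)
  qed (use act in \<open>auto simp: space_borel_X3\<close>)
  then show ?thesis by (simp add: borel_X3_def)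
qed

lemma hits_X3_sets:
  assumes "open S"
  shows "{x \<in> X3. \<exists>g\<in>x. hits g S} \<in> sets borel_X3"
proof (rule borel_X3_open)
  have "{g \<in> SL3R. SL3Z_coset g \<in> {x \<in> X3. \<exists>g\<in>x. hits g S}} = SL3R \<inter> {g. hits g S}"
    using hits_coset[of _ "mat 1" S] by (auto simp: X3_def)
  moreover have "open {g. hits g S}"
    using assms by (intro open_hits continuous_intros)
  ultimately show "openin (top_of_set SL3R) {g \<in> SL3R. SL3Z_coset g \<in> {x \<in> X3. \<exists>g\<in>x. hits g S}}"
    by (simp add: openin_open_Int)
qed auto

text \<open>Fubini requires joint measurability in a sigma-algebra generated by rectangles. The open
  set of pairs (v, A) with v A in \<open>S\<close> is a union of countably many basic boxes U x V,
  and each contributes the rectangle of the cosets hitting U times V.\<close>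

lemma hits_X3_product_sets:
  assumes "open S" "sets \<mu> = sets borel_X3"
  shows "{z \<in> space (\<mu> \<Otimes>\<^sub>M lborel). \<exists>g\<in>fst z. hits (g ** snd z) S} \<in> sets (\<mu> \<Otimes>\<^sub>M lborel)"
proof -
  have space: "space \<mu> = X3"
    using sets_eq_imp_space_eq[OF assms(2)] by (simp add: space_borel_X3)
  obtain \<B> :: "(real^3) set set" where \<B>: "countable \<B>" "topological_basis \<B>"
    using ex_countable_basis by blast
  obtain \<C> :: "(real^3^3) set set" where \<C>: "countable \<C>" "topological_basis \<C>"
    using ex_countable_basis by blast
  define W where "W = {p :: (real^3) \<times> (real^3^3). fst p v* snd p \<in> S}"
  have "open W"
  proof -
    have "open ((\<lambda>p :: (real^3) \<times> (real^3^3). fst p v* snd p) -` S)"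
      by (intro open_vimage assms(1) continuous_intros)
    then show ?thesis by (simp add: W_def vimage_def)
  qed
  have basis: "\<exists>U\<in>\<B>. \<exists>V\<in>\<C>. p \<in> U \<times> V \<and> U \<times> V \<subseteq> W" if p: "p \<in> W" for p
  proof -
    obtain U0 V0 where UV0: "open U0" "open V0" "p \<in> U0 \<times> V0" "U0 \<times> V0 \<subseteq> W"
      using open_prod_elim[OF \<open>open W\<close> p] by blast
    then have p': "fst p \<in> U0" "snd p \<in> V0" by auto
    obtain U where "U \<in> \<B>" "fst p \<in> U" "U \<subseteq> U0"
      by (rule topological_basisE[OF \<B>(2) UV0(1) p'(1)])
    moreover obtain V where "V \<in> \<C>" "snd p \<in> V" "V \<subseteq> V0"
      by (rule topological_basisE[OF \<C>(2) UV0(2) p'(2)])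
    ultimately show ?thesis using UV0(4) by (intro bexI[of _ U] bexI[of _ V]) (auto simp: mem_Times_iff)
  qed
  define I where "I = {(U, V). U \<in> \<B> \<and> V \<in> \<C> \<and> U \<times> V \<subseteq> W}"
  have "countable I"
    by (rule countable_subset[of _ "\<B> \<times> \<C>"]) (use \<B> \<C> in \<open>auto simp: I_def\<close>)
  have "{z \<in> space (\<mu> \<Otimes>\<^sub>M lborel). \<exists>g\<in>fst z. hits (g ** snd z) S}
      = (\<Union>(U, V)\<in>I. {x \<in> X3. \<exists>g\<in>x. hits g U} \<times> V)" (is "?L = ?R")
  proof (intro equalityI subsetI)
    fix z assume "z \<in> ?L"
    then have "fst z \<in> X3" "\<exists>g\<in>fst z. \<exists>n\<in>int_vectors - {0}. (n v* g) v* snd z \<in> S"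
      unfolding hits_def vector_matrix_mul_assoc by (auto simp: space_pair_measure space)
    then obtain g n where z: "fst z \<in> X3" "g \<in> fst z" and n: "n \<in> int_vectors - {0}" "(n v* g) v* snd z \<in> S"
      by blast
    then obtain U V where UV: "U \<in> \<B>" "V \<in> \<C>" "(n v* g, snd z) \<in> U \<times> V" "U \<times> V \<subseteq> W"
      using basis[of "(n v* g, snd z)"] by (auto simp: W_def)
    then have "z \<in> {x \<in> X3. \<exists>g\<in>x. hits g U} \<times> V"
      using z n by (auto simp: hits_def mem_Times_iff)
    moreover have "(U, V) \<in> I" using UV by (auto simp: I_def)
    ultimately show "z \<in> ?R" by blast
  next
    fix z assume "z \<in> ?R"
    then obtain U V where UV: "(U, V) \<in> I" "z \<in> {x \<in> X3. \<exists>g\<in>x. hits g U} \<times> V" by auto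
    then have "fst z \<in> X3" "snd z \<in> V" "\<exists>g\<in>fst z. \<exists>n\<in>int_vectors - {0}. n v* g \<in> U"
      unfolding hits_def by auto
    then obtain g n where g: "fst z \<in> X3" "g \<in> fst z" "snd z \<in> V" and n: "n \<in> int_vectors - {0}" "n v* g \<in> U"
      by blast
    then have "(n v* g, snd z) \<in> W" using UV(1) by (auto simp: I_def)
    then have "hits (g ** snd z) S"
      using n by (auto simp: hits_def W_def vector_matrix_mul_assoc)
    then show "z \<in> ?L" using g by (auto simp: space_pair_measure space mem_Times_iff)
  qed
  also have "\<dots> \<in> sets (\<mu> \<Otimes>\<^sub>M lborel)"
  proof (rule sets.countable_UN''[OF \<open>countable I\<close>])
    fix i assume "i \<in> I"
    then obtain U V where i: "i = (U, V)" "U \<in> \<B>" "V \<in> \<C>" by (auto simp: I_def)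
    then have "open U" "open V" using \<B> \<C> by (auto simp: topological_basis_open)
    then have "{x \<in> X3. \<exists>g\<in>x. hits g U} \<times> V \<in> sets (\<mu> \<Otimes>\<^sub>M lborel)"
      using hits_X3_sets assms(2) by (intro pair_measureI) auto
    then show "(case i of (U, V) \<Rightarrow> {x \<in> X3. \<exists>g\<in>x. hits g U} \<times> V) \<in> sets (\<mu> \<Otimes>\<^sub>M lborel)"
      by (simp add: i)
  qed
  finally show ?thesis .
qed

section \<open>Exchanging lattice and matrix, and invariance of the measure\<close>

definition good_X3 :: "real \<Rightarrow> (real^3^3) set \<Rightarrow> real^3^3 \<Rightarrow> bool" where
  "good_X3 \<tau> x A \<longleftrightarrow> (\<exists>C::nat. \<forall>\<^sub>F k in sequentially. \<exists>g\<in>x. hits (g ** A) (window \<tau> C k))"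

text \<open>In \<open>good_X3\<close> the representative may depend on \<open>k\<close>, which makes
  each stage a measurable condition on the coset; \<open>hits_coset\<close> shows that this changes
  nothing.\<close>

lemma good_X3_coset: "good_X3 \<tau> (SL3Z_coset g) A \<longleftrightarrow> good \<tau> (g ** A)"
  by (simp add: good_X3_def good_def hits_coset)

lemma good_X3_sets:
  assumes "sets \<mu> = sets borel_X3"
  shows "{z \<in> space (\<mu> \<Otimes>\<^sub>M lborel). good_X3 \<tau> (fst z) (snd z)} \<in> sets (\<mu> \<Otimes>\<^sub>M lborel)"
proof -
  have [measurable]: "Measurable.pred (\<mu> \<Otimes>\<^sub>M lborel) (\<lambda>z. \<exists>g\<in>fst z. hits (g ** snd z) (window \<tau> C k))" for C k
    using hits_X3_product_sets[OF open_window assms] by (simp add: pred_def)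
  have "Measurable.pred (\<mu> \<Otimes>\<^sub>M lborel) (\<lambda>z. good_X3 \<tau> (fst z) (snd z))"
    unfolding good_X3_def eventually_sequentially by measurable
  then show ?thesis by (simp add: pred_def)
qed

theorem theorem2:
  fixes N :: "real^3 \<Rightarrow> real" and \<tau> :: real and \<mu> :: "(real^3^3) set measure"
  assumes "is_norm N" and "0 < \<tau>" and "\<tau> < 1" and "invariant_prob_X3 \<mu>"
  shows "AE x in \<mu>. \<forall>g\<in>x. \<exists>c>0. \<forall>\<^sub>F T in at_top.
           \<exists>n \<in> int_vectors - {0}. N n < T \<and> \<bar>Q0_twist g n\<bar> \<le> c * T powr (- \<tau>)"
proof -
  have \<mu>: "prob_space \<mu>" "sets \<mu> = sets borel_X3" "\<And>h. h \<in> SL3R \<Longrightarrow> distr \<mu> \<mu> (X3_act h) = \<mu>"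
    using assms(4) by (auto simp: invariant_prob_X3_def)
  have space: "space \<mu> = X3"
    using sets_eq_imp_space_eq[OF \<mu>(2)] by (simp add: space_borel_X3)
  interpret prob_space \<mu> by fact
  interpret pair_sigma_finite \<mu> "lborel :: (real^3^3) measure" ..
  \<comment> \<open>This holds for every single coset: left multiplication by a representative
    preserves null sets of matrices.\<close>
  have "AE x in \<mu>. AE A in lborel. det A \<noteq> 0 \<longrightarrow> good_X3 \<tau> x A"
  proof (rule AE_I2)
    fix x assume "x \<in> space \<mu>"
    then obtain g where g: "x = SL3Z_coset g" "det g = 1" by (auto simp: space X3_def SL3R_def)
    have "AE A in lborel. det (g ** A) \<noteq> 0 \<longrightarrow> good \<tau> (g ** A)"
      using g(2) AE_good[OF assms(2,3)]
      by (intro AE_lborel_matrix_mult[where P = "\<lambda>A. det A \<noteq> 0 \<longrightarrow> good \<tau> A"]) auto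
    then show "AE A in lborel. det A \<noteq> 0 \<longrightarrow> good_X3 \<tau> x A"
      by (simp add: g good_X3_coset det_mul)
  qed
  moreover have "{z \<in> space (\<mu> \<Otimes>\<^sub>M lborel). det (snd z) \<noteq> 0 \<longrightarrow> good_X3 \<tau> (fst z) (snd z)} \<in> sets (\<mu> \<Otimes>\<^sub>M lborel)"
  proof -
    have [measurable]: "Measurable.pred (\<mu> \<Otimes>\<^sub>M lborel) (\<lambda>z. good_X3 \<tau> (fst z) (snd z))"
      using good_X3_sets[OF \<mu>(2)] by (simp add: pred_def)
    have [measurable]: "(det :: real^3^3 \<Rightarrow> real) \<in> borel_measurable borel"
      by (intro borel_measurable_continuous_onI continuous_intros)
    show ?thesis by measurable
  qed
  ultimately have "AE A in lborel. AE x in \<mu>. det A \<noteq> 0 \<longrightarrow> good_X3 \<tau> x A"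
    using AE_commute[of "\<lambda>x A. det A \<noteq> 0 \<longrightarrow> good_X3 \<tau> x A"] by simp
  \<comment> \<open>Matrices of positive determinant form a nonempty open set, so a property of
    almost every matrix holds for one of them.\<close>
  moreover have "\<not> (AE A in lborel. \<not> det (A :: real^3^3) > 0)"
  proof -
    have "open {A :: real^3^3. det A > 0}"
      by (intro open_Collect_less continuous_intros)
    moreover have "mat 1 \<in> {A :: real^3^3. det A > 0}" by simp
    ultimately have "\<not> negligible {A :: real^3^3. det A > 0}"
      using open_not_negligible by blast
    then show ?thesis by (simp add: AE_lborel_iff_negligible)
  qed
  ultimately obtain A where A: "det A > 0" "AE x in \<mu>. det A \<noteq> 0 \<longrightarrow> good_X3 \<tau> x A"
    by (metis (mono_tags, lifting) AE_mp AE_I2)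
  \<comment> \<open>The cube root of the determinant scales \<open>A\<close> into
    \<open>SL3R\<close>, and \<open>good_scaleR\<close> keeps the property.\<close>
  define h where "h = (1 / root 3 (det A)) *\<^sub>R A"
  have r: "root 3 (det A) > 0" using A by simp
  have "det h = (1 / root 3 (det A)) ^ 3 * det A"
    unfolding h_def by (rule det_scaleR_3)
  also have "\<dots> = 1" using A by (simp add: power_one_over)
  finally have h: "h \<in> SL3R" by (simp add: SL3R_def)
  \<comment> \<open>The property of \<open>x\<close> relative to \<open>h\<close> is a property of
    the translated coset alone, so invariance of \<open>\<mu>\<close> under \<open>h\<close>
    transfers it to almost every coset.\<close>
  have "AE x in \<mu>. good_X3 \<tau> (X3_act h x) (mat 1)"
    using A(2)
  proof (rule AE_mp, intro AE_I2 impI)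
    fix x assume "x \<in> space \<mu>" "det A \<noteq> 0 \<longrightarrow> good_X3 \<tau> x A"
    then obtain g where g: "x = SL3Z_coset g" "good \<tau> (g ** A)"
      using A(1) by (auto simp: space X3_def good_X3_coset)
    then have "good \<tau> (g ** h)"
      using good_scaleR[of \<tau> "g ** A" "1 / root 3 (det A)"] r
      by (simp add: h_def matrix_mult_scaleR_right)
    then show "good_X3 \<tau> (X3_act h x) (mat 1)"
      by (simp add: g X3_act_coset good_X3_coset)
  qed
  moreover have "{x \<in> space \<mu>. good_X3 \<tau> x (mat 1)} \<in> sets \<mu>"
  proof -
    have "(\<lambda>x. (x, mat 1)) \<in> measurable \<mu> (\<mu> \<Otimes>\<^sub>M lborel)" by measurable
    from measurable_sets[OF this good_X3_sets[OF \<mu>(2), of \<tau>]] show ?thesis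
      by (simp add: vimage_def Int_def space_pair_measure conj_commute)
  qed
  moreover have "X3_act h \<in> measurable \<mu> \<mu>"
    using X3_act_measurable[OF h] measurable_cong_sets[OF \<mu>(2) \<mu>(2)] by simp
  ultimately have "AE x in distr \<mu> \<mu> (X3_act h). good_X3 \<tau> x (mat 1)"
    by (simp add: AE_distr_iff)
  then have "AE x in \<mu>. good_X3 \<tau> x (mat 1)"
    unfolding \<mu>(3)[OF h] .
  then show ?thesis
  proof (rule AE_mp, intro AE_I2 impI ballI)
    fix x g assume x: "x \<in> space \<mu>" "good_X3 \<tau> x (mat 1)" "g \<in> x"
    then obtain g0 \<gamma> where g: "x = SL3Z_coset g0" "g0 \<in> SL3R" "\<gamma> \<in> SL3Z" "g = \<gamma> ** g0"
      by (auto simp: space X3_def SL3Z_coset_def)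
    \<comment> \<open>\<open>good\<close> is invariant under \<open>\<gamma>\<close>, so it passes
      from \<open>g0\<close> to every representative.\<close>
    then have "good \<tau> g"
      using x(2) by (simp add: good_X3_coset) (simp add: good_def hits_SL3Z)
    moreover have "det g \<noteq> 0" using g by (simp add: det_mul SL3R_def SL3Z_def)
    ultimately show "\<exists>c>0. \<forall>\<^sub>F T in at_top.
        \<exists>n \<in> int_vectors - {0}. N n < T \<and> \<bar>Q0_twist g n\<bar> \<le> c * T powr (- \<tau>)"
      using assms by (intro good_imp_small_values) auto
  qed
qed

end
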